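(* Let $(\mathcal{C},\tau)$ be a non-commutative probability space, let $\mathcal{A},\mathcal{B}\subset\mathcal{C}$ be $\ast$-subalgebras with $1_{\mathcal{C}}\in\mathcal{B}$ and $\mathcal{A}=M_\infty(\mathbb{C})$. Let $a_1,\dots,a_p\in\mathcal{A}$ and $b_0,\dots,b_q\in\mathcal{B}$ be self-adjoint with $b_0=1$, $\tau(b_i)=0$ for $1\le i\le q$, and $\tau(b_ib_j)=\delta_{ij}$ for $0\le i,j\le q$. Let $$P=\sum_{i_1,i_2=0}^{q}\sum_{j_1=1}^{p}\lambda_{i_1,i_2,j_1}\,b_{i_1}a_{j_1}b_{i_2}+R,$$ where $\lambda_{i_1,i_2,j_1}\in\mathbb{C}$ and $R$ is a linear combination of alternating monomials in the $a_i$ and the $b_j$, $j\neq0$, each containing at least two $a$'s. For $n$ large enough that $a_1,\dots,a_p\in M_n(\mathbb{C})$, let $$\tilde P=\tilde P_n=\sum_{i_1,i_2=0}^{q}\sum_{j_1=1}^{p}\lambda_{i_1,i_2,j_1}\,\tilde b_{i_1,n}\,\phi(a_{j_1})\,\tilde b_{i_2,n}\in M_n(\mathbb{C})\otimes M_{2^q}(\mathbb{C})\subset M_\infty(\mathbb{C})$$ be its tensor model, and let $\eta_l:M_\infty(\mathbb{C})\to\mathbb{C}$, $\eta_l(x)=\sum_{r=1}^{l}x_{rr}$. Let $k\ge1$ be an integer. (i) If $\omega$ is a tracial weight on $\mathcal{C}$ with $\omega|_{\mathcal{A}}=\mathrm{Tr}$ and $(\mathcal{A},\mathcal{B})$ is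 cyclically monotonically independent with respect to $(\tau,\omega)$, then $$\omega(P^k)=\lim_{n\to\infty}\lim_{l\to\infty}\eta_l(\tilde P_n^k).$$ (ii) If $\tilde\omega$ is a linear functional defined on a $\ast$-subalgebra $\mathrm{D}(\tilde\omega)$ of $\mathcal{C}$ with $\tilde\omega|_{\mathcal{A}}=\mathrm{Tr}$ and $(\mathcal{A},\mathcal{B})$ is monotonically independent with respect to $(\tau,\tilde\omega)$, then $$\tilde\omega(P^k)=\lim_{l\to\infty}\lim_{n\to\infty}\eta_l(\tilde P_n^k).$$
   Context: A tracial weight $\omega$ on a $\ast$-algebra $\mathcal{C}$ is a linear functional defined on a (possibly non-unital) $\ast$-subalgebra $\mathrm{D}(\omega)\subset\mathcal{C}$ with $\omega(a^*a)\ge0$, $\omega(a^* )=\overline{\omega(a)}$, $\omega(ab)=\omega(ba)$ for $a,b\in \mathrm{D}(\omega)$. A non-commutative probability space $(\mathcal{C},\tau)$ is a unital $\ast$-algebra over $\mathbb{C}$ with a tracial weight $\tau$ satisfying $\mathrm{D}(\tau)=\mathcal{C}$ and $\tau(1)=1$. For $\ast$-subalgebras $\mathcal{A},\mathcal{B}\subset\mathcal{C}$ with $1_{\mathcal{C}}\in\mathcal{B}$, $\mathrm{Ideal}_{\mathcal{B}}(\mathcal{A})=\mathrm{span}\{b_0a_1b_1\cdots a_nb_n: n\in\mathbb{N},\,a_i\in\mathcal{A},\,b_i\in\mathcal{B}\}$ (with $n\ge1$). The pair $(\mathcal{A},\mathcal{B})$ is cyclically monotonically independent with respect to $(\tau,\omega)$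 if $\mathrm{Ideal}_{\mathcal{B}}(\mathcal{A})\subset \mathrm{D}(\omega)$ and for all $n\ge1$, $a_i\in\mathcal{A}$, $b_i\in\mathcal{B}$, $$\omega(b_0a_1b_1\cdots a_nb_n)=\omega(a_1\cdots a_n)\,\tau(b_1)\cdots\tau(b_{n-1})\,\tau(b_nb_0).$$ It is monotonically independent with respect to $(\tau,\tilde\omega)$ if $\mathrm{Ideal}_{\mathcal{B}}(\mathcal{A})\subset \mathrm{D}(\tilde\omega)$ and for all $n\ge1$, $a_i\in\mathcal{A}$, $b_i\in\mathcal{B}$, $$\tilde\omega(b_0a_1b_1\cdots a_nb_n)=\tilde\omega(a_1\cdots a_n)\,\tau(b_0)\tau(b_1)\cdots\tau(b_n).$$ $M_\infty(\mathbb{C})$ is the inductive limit of the $M_n(\mathbb{C})$ under the non-unital embeddings $M_n(\mathbb{C})\to M_m(\mathbb{C})$ ($n<m$), $a\mapsto\begin{pmatrix}a&0\\0&0\end{pmatrix}$, and $\mathrm{Tr}$ on $M_\infty(\mathbb{C})$ is the trace induced by the non-normalized traces $\mathrm{Tr}_n$ on $M_n(\mathbb{C})$. An alternating monomial is one in which factors $a_i$ and factors $b_j$ ($j\neq 0$) alternate; in particular any two consecutive $a$'s are separated by exactly one $b_j$ with $j\ne0$ (it may begin and end with either an $a$ or a $b$). Tensor model: let $I_n$ be the $n\times n$ identity matrix, $J=\begin{pmatrix}0&1\\1&0\end{pmatrix}$, $E_{11}=\begin{pmatrix}1&0\\0&0\end{pmatrix}$, and identify $M_{2^q}(\mathbb{C})=M_2(\mathbb{C})^{\otimes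 q}$. Put $B_0=I_{2^q}$ and, for $1\le i\le q$, $B_i=I_2\otimes\cdots\otimes J\otimes\cdots\otimes I_2$ ($q$ tensor factors, $J$ in position $i$). Then $\tilde b_{i,n}=I_n\otimes B_i$ for $0\le i\le q$, and $\phi(a)=a\otimes E_{11}^{\otimes q}$ for $a\in M_n(\mathbb{C})$. The algebra $M_n(\mathbb{C})\otimes M_{2^q}(\mathbb{C})$ is identified with $M_{n2^q}(\mathbb{C})$, viewed as $2^q\times2^q$ block matrices with blocks in $M_n(\mathbb{C})$, so that $\phi(a)$ is the matrix with $a$ as its upper left $n\times n$ block and zeros elsewhere; it is then embedded in $M_\infty(\mathbb{C})$ as an upper left corner. The integer $q$ is fixed while $n,l\to\infty$. *)

theory Defs
  imports Complex_Main "Jordan_Normal_Form.Matrix"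
begin

section \<open>Complex star-algebras\<close>

class star_algebra = ring +
  fixes scaleC :: "complex \<Rightarrow> 'a \<Rightarrow> 'a" (infixr \<open>*\<^sub>C\<close> 75)
    and star :: "'a \<Rightarrow> 'a"
  assumes scaleC_add_right: "r *\<^sub>C (x + y) = r *\<^sub>C x + r *\<^sub>C y"
    and scaleC_add_left: "(r + s) *\<^sub>C x = r *\<^sub>C x + s *\<^sub>C x"
    and scaleC_scaleC: "r *\<^sub>C (s *\<^sub>C x) = (r * s) *\<^sub>C x"
    and scaleC_one: "1 *\<^sub>C x = x"
    and mult_scaleC_left: "(r *\<^sub>C x) * y = r *\<^sub>C (x * y)"
    and mult_scaleC_right: "x * (r *\<^sub>C y) = r *\<^sub>C (x * y)"
    and star_star: "star (star x) = x"
    and star_add: "star (x + y) = star x + star y"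
    and star_scaleC: "star (r *\<^sub>C x) = cnj r *\<^sub>C star x"
    and star_mult: "star (x * y) = star y * star x"

class star_algebra_1 = star_algebra + ring_1

global_interpretation complex_space: vector_space "scaleC :: complex \<Rightarrow> 'a \<Rightarrow> 'a::star_algebra"
  defines cspan = "complex_space.span"
  by unfold_locales (simp_all add: scaleC_add_right scaleC_add_left scaleC_scaleC scaleC_one)

definition star_subalgebra :: "'a::star_algebra set \<Rightarrow> bool" where
  "star_subalgebra S \<longleftrightarrow> 0 \<in> S \<and> (\<forall>x\<in>S. \<forall>y\<in>S. x + y \<in> S \<and> x * y \<in> S)
     \<and> (\<forall>r. \<forall>x\<in>S. r *\<^sub>C x \<in> S) \<and> (\<forall>x\<in>S. star x \<in> S)"

definition star_hom :: "('a::star_algebra \<Rightarrow> 'b::star_algebra) \<Rightarrow> bool" where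
  "star_hom f \<longleftrightarrow> (\<forall>x y. f (x + y) = f x + f y) \<and> (\<forall>x y. f (x * y) = f x * f y)
     \<and> (\<forall>r x. f (r *\<^sub>C x) = r *\<^sub>C f x) \<and> (\<forall>x. f (star x) = star (f x))"

text \<open>A partially defined functional is a pair of a domain \<open>D\<close> and a total function whose
  values outside \<open>D\<close> are irrelevant.\<close>

definition linear_functional_on :: "'a::star_algebra set \<Rightarrow> ('a \<Rightarrow> complex) \<Rightarrow> bool" where
  "linear_functional_on D \<omega> \<longleftrightarrow> star_subalgebra D
     \<and> (\<forall>x\<in>D. \<forall>y\<in>D. \<omega> (x + y) = \<omega> x + \<omega> y) \<and> (\<forall>r. \<forall>x\<in>D. \<omega> (r *\<^sub>C x) = r * \<omega> x)"

definition tracial_weight :: "'a::star_algebra set \<Rightarrow> ('a \<Rightarrow> complex) \<Rightarrow> bool" where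
  "tracial_weight D \<omega> \<longleftrightarrow> linear_functional_on D \<omega>
     \<and> (\<forall>a\<in>D. Im (\<omega> (star a * a)) = 0 \<and> 0 \<le> Re (\<omega> (star a * a)))
     \<and> (\<forall>a\<in>D. \<omega> (star a) = cnj (\<omega> a))
     \<and> (\<forall>a\<in>D. \<forall>b\<in>D. \<omega> (a * b) = \<omega> (b * a))"

definition nc_probability_space :: "('a::star_algebra_1 \<Rightarrow> complex) \<Rightarrow> bool" where
  "nc_probability_space \<tau> \<longleftrightarrow> tracial_weight UNIV \<tau> \<and> \<tau> 1 = 1"

section \<open>Independence\<close>

text \<open>The product $b_0 a_1 b_1 \cdots a_n b_n$.\<close>

definition word_prod :: "nat \<Rightarrow> (nat \<Rightarrow> 'a::monoid_mult) \<Rightarrow> (nat \<Rightarrow> 'a) \<Rightarrow> 'a" where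
  "word_prod n a b = b 0 * prod_list (map (\<lambda>i. a i * b i) [1..<Suc n])"

definition ideal_over :: "'a::star_algebra_1 set \<Rightarrow> 'a set \<Rightarrow> 'a set" where
  "ideal_over B A = cspan {word_prod n a b | n a b.
     1 \<le> n \<and> (\<forall>i\<in>{1..n}. a i \<in> A) \<and> (\<forall>i\<in>{0..n}. b i \<in> B)}"

definition cyclically_monotone ::
  "'a::star_algebra_1 set \<Rightarrow> 'a set \<Rightarrow> ('a \<Rightarrow> complex) \<Rightarrow> 'a set \<Rightarrow> ('a \<Rightarrow> complex) \<Rightarrow> bool" where
  "cyclically_monotone A B \<tau> D \<omega> \<longleftrightarrow> ideal_over B A \<subseteq> D
     \<and> (\<forall>n a b. 1 \<le> n \<longrightarrow> (\<forall>i\<in>{1..n}. a i \<in> A) \<longrightarrow> (\<forall>i\<in>{0..n}. b i \<in> B) \<longrightarrow>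
          \<omega> (word_prod n a b)
            = \<omega> (prod_list (map a [1..<Suc n])) * (\<Prod>i\<in>{1..<n}. \<tau> (b i)) * \<tau> (b n * b 0))"

definition monotone_indep ::
  "'a::star_algebra_1 set \<Rightarrow> 'a set \<Rightarrow> ('a \<Rightarrow> complex) \<Rightarrow> 'a set \<Rightarrow> ('a \<Rightarrow> complex) \<Rightarrow> bool" where
  "monotone_indep A B \<tau> D \<omega> \<longleftrightarrow> ideal_over B A \<subseteq> D
     \<and> (\<forall>n a b. 1 \<le> n \<longrightarrow> (\<forall>i\<in>{1..n}. a i \<in> A) \<longrightarrow> (\<forall>i\<in>{0..n}. b i \<in> B) \<longrightarrow>
          \<omega> (word_prod n a b) = \<omega> (prod_list (map a [1..<Suc n])) * (\<Prod>i\<in>{0..n}. \<tau> (b i)))"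

section \<open>The algebra of finitely supported infinite matrices\<close>

text \<open>The inductive limit of the matrix algebras along the upper left corner embeddings is
  realised by the infinite matrices, indexed from 0, that vanish outside some \<open>n \<times> n\<close> upper left
  corner; the canonical maps into the limit are given by \<open>mat_embed\<close> below.\<close>

typedef minf = "{x :: nat \<Rightarrow> nat \<Rightarrow> complex. \<exists>n. \<forall>i j. n \<le> i \<or> n \<le> j \<longrightarrow> x i j = 0}"
  morphisms entry Abs_minf
  by auto

setup_lifting type_definition_minf

lemma minf_eqI: "(\<And>i j. entry x i j = entry y i j) \<Longrightarrow> x = y"
  by (metis entry_inject ext)

lemma entry_bound: obtains n where "\<And>i j. n \<le> i \<or> n \<le> j \<Longrightarrow> entry x i j = 0"
  using entry[of x] that by blast

lemma minf_sum_bound: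
  fixes x :: "nat \<Rightarrow> complex"
  assumes "\<And>k. n \<le> k \<Longrightarrow> x k = 0"
  shows "(\<Sum>k | x k \<noteq> 0. x k * y k) = (\<Sum>k<n. x k * y k)"
  by (rule sum.mono_neutral_left) (use assms in \<open>auto simp: not_le[symmetric]\<close>)

instantiation minf :: star_algebra
begin

lift_definition zero_minf :: minf is "\<lambda>i j. 0" by simp

lift_definition plus_minf :: "minf \<Rightarrow> minf \<Rightarrow> minf" is "\<lambda>x y i j. x i j + y i j"
proof -
  fix x y :: "nat \<Rightarrow> nat \<Rightarrow> complex"
  assume "\<exists>n. \<forall>i j. n \<le> i \<or> n \<le> j \<longrightarrow> x i j = 0" "\<exists>n. \<forall>i j. n \<le> i \<or> n \<le> j \<longrightarrow> y i j = 0"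
  then obtain n m where "\<forall>i j. n \<le> i \<or> n \<le> j \<longrightarrow> x i j = 0" "\<forall>i j. m \<le> i \<or> m \<le> j \<longrightarrow> y i j = 0"
    by blast
  then show "\<exists>n. \<forall>i j. n \<le> i \<or> n \<le> j \<longrightarrow> x i j + y i j = 0"
    by (intro exI[of _ "max n m"]) auto
qed

lift_definition uminus_minf :: "minf \<Rightarrow> minf" is "\<lambda>x i j. - x i j" by simp

definition minus_minf :: "minf \<Rightarrow> minf \<Rightarrow> minf" where "minus_minf x y = x + - y"

lift_definition scaleC_minf :: "complex \<Rightarrow> minf \<Rightarrow> minf" is "\<lambda>r x i j. r * x i j" by auto

lift_definition star_minf :: "minf \<Rightarrow> minf" is "\<lambda>x i j. cnj (x j i)"
  by (metis complex_cnj_zero)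

text \<open>Since \<open>x\<close> has finite support, the sum below is the full matrix product sum.\<close>

lift_definition times_minf :: "minf \<Rightarrow> minf \<Rightarrow> minf" is
  "\<lambda>x y i j. \<Sum>k | x i k \<noteq> 0. x i k * y k j"
proof -
  fix x y :: "nat \<Rightarrow> nat \<Rightarrow> complex"
  assume "\<exists>n. \<forall>i j. n \<le> i \<or> n \<le> j \<longrightarrow> x i j = 0" "\<exists>n. \<forall>i j. n \<le> i \<or> n \<le> j \<longrightarrow> y i j = 0"
  then obtain n m where "\<forall>i j. n \<le> i \<or> n \<le> j \<longrightarrow> x i j = 0" "\<forall>i j. m \<le> i \<or> m \<le> j \<longrightarrow> y i j = 0"
    by blast
  then show "\<exists>n. \<forall>i j. n \<le> i \<or> n \<le> j \<longrightarrow> (\<Sum>k | x i k \<noteq> 0. x i k * y k j) = 0"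
    by (intro exI[of _ "max n m"]) (auto intro!: sum.neutral)
qed

lemma entry_times_bound:
  assumes "\<And>i j. n \<le> j \<Longrightarrow> entry x i j = 0"
  shows "entry (x * y) i j = (\<Sum>k<n. entry x i k * entry y k j)"
  by (simp add: times_minf.rep_eq minf_sum_bound[OF assms])

instance
proof
  fix x y z :: minf and r s :: complex
  obtain n1 where n1: "\<And>i j. n1 \<le> i \<or> n1 \<le> j \<Longrightarrow> entry x i j = 0"
    using entry_bound[of x] by metis
  obtain n2 where n2: "\<And>i j. n2 \<le> i \<or> n2 \<le> j \<Longrightarrow> entry y i j = 0"
    using entry_bound[of y] by metis
  define n where "n = max n1 n2"
  have x: "entry x i j = 0" if "n \<le> i \<or> n \<le> j" for i j using that n1 by (auto simp: n_def)
  have y: "entry y i j = 0" if "n \<le> i \<or> n \<le> j" for i j using that n2 by (auto simp: n_def)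
  have xy: "entry (x * y) i j = (\<Sum>k<n. entry x i k * entry y k j)" for y i j
    by (rule entry_times_bound) (simp add: x)
  have yz: "entry (y * z) i j = (\<Sum>k<n. entry y i k * entry z k j)" for z i j
    by (rule entry_times_bound) (simp add: y)
  have xy0: "entry (x * y) i j = 0" if "n \<le> j" for i j
    using that y by (simp add: xy)
  have xyz: "entry (x * y * z) i j = (\<Sum>k<n. entry (x * y) i k * entry z k j)" for i j
    by (rule entry_times_bound) (simp add: xy0)
  have xpy: "entry ((x + y) * z) i j = (\<Sum>k<n. entry (x + y) i k * entry z k j)" for i j
    by (rule entry_times_bound) (simp add: x y plus_minf.rep_eq)
  have rx: "entry ((r *\<^sub>C x) * y) i j = (\<Sum>k<n. entry (r *\<^sub>C x) i k * entry y k j)" for i j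
    by (rule entry_times_bound) (simp add: x scaleC_minf.rep_eq)
  have sy: "entry (star y * star x) i j = (\<Sum>k<n. entry (star y) i k * entry (star x) k j)" for i j
    by (rule entry_times_bound) (simp add: y star_minf.rep_eq)
  show "x * y * z = x * (y * z)"
  proof (rule minf_eqI)
    fix i j
    have "entry (x * y * z) i j = (\<Sum>l<n. \<Sum>k<n. entry x i k * entry y k l * entry z l j)"
      by (simp add: xyz xy sum_distrib_right)
    also have "\<dots> = (\<Sum>k<n. \<Sum>l<n. entry x i k * entry y k l * entry z l j)"
      by (rule sum.swap)
    also have "\<dots> = entry (x * (y * z)) i j"
      by (simp add: xy yz sum_distrib_left mult.assoc)
    finally show "entry (x * y * z) i j = entry (x * (y * z)) i j" .
  qed
  show "(x + y) * z = x * z + y * z"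
    by (rule minf_eqI)
      (simp add: xpy plus_minf.rep_eq xy yz sum.distrib distrib_right)
  show "x * (y + z) = x * y + x * z"
    by (rule minf_eqI) (simp add: plus_minf.rep_eq xy sum.distrib distrib_left)
  show "(r *\<^sub>C x) * y = r *\<^sub>C (x * y)"
    by (rule minf_eqI) (simp add: rx xy scaleC_minf.rep_eq sum_distrib_left mult.assoc)
  show "x * (r *\<^sub>C y) = r *\<^sub>C (x * y)"
    by (rule minf_eqI) (simp add: xy scaleC_minf.rep_eq sum_distrib_left mult.left_commute)
  show "star (x * y) = star y * star x"
    by (rule minf_eqI) (simp add: sy star_minf.rep_eq xy mult.commute)
  show "x + y + z = x + (y + z)" "x + y = y + x" "0 + x = x" "- x + x = 0"
    "r *\<^sub>C (x + y) = r *\<^sub>C x + r *\<^sub>C y" "(r + s) *\<^sub>C x = r *\<^sub>C x + s *\<^sub>C x"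
    "r *\<^sub>C (s *\<^sub>C x) = (r * s) *\<^sub>C x" "1 *\<^sub>C x = x"
    "star (star x) = x" "star (x + y) = star x + star y" "star (r *\<^sub>C x) = cnj r *\<^sub>C star x"
    by (rule minf_eqI, simp add: plus_minf.rep_eq zero_minf.rep_eq uminus_minf.rep_eq
        scaleC_minf.rep_eq star_minf.rep_eq algebra_simps)+
  show "x - y = x + - y" by (rule minus_minf_def)
qed

end

text \<open>The canonical map of an \<open>n \<times> n\<close> matrix into the upper left corner, the image \<open>M_corner n\<close> of
  the \<open>n \<times> n\<close> matrices, and the inverse map (truncation) on that image.\<close>

lift_definition mat_embed :: "complex mat \<Rightarrow> minf" is
  "\<lambda>A i j. if i < dim_row A \<and> j < dim_col A then A $$ (i, j) else 0"
proof -
  fix A :: "complex mat"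
  show "\<exists>n. \<forall>i j. n \<le> i \<or> n \<le> j \<longrightarrow>
      (if i < dim_row A \<and> j < dim_col A then A $$ (i, j) else 0) = 0"
    by (rule exI[of _ "max (dim_row A) (dim_col A)"]) auto
qed

definition M_corner :: "nat \<Rightarrow> minf set" where
  "M_corner n = mat_embed ` carrier_mat n n"

definition corner :: "nat \<Rightarrow> minf \<Rightarrow> complex mat" where
  "corner n x = mat n n (\<lambda>(i, j). entry x i j)"

definition Tr :: "minf \<Rightarrow> complex" where
  "Tr x = (\<Sum>i | entry x i i \<noteq> 0. entry x i i)"

definition eta :: "nat \<Rightarrow> minf \<Rightarrow> complex" where
  "eta l x = (\<Sum>r<l. entry x r r)"

text \<open>The algebra has no unit, so only the powers with exponent \<open>k \<ge> 1\<close> are meaningful.\<close>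

definition minf_power :: "minf \<Rightarrow> nat \<Rightarrow> minf" where
  "minf_power x k = ((\<lambda>y. x * y) ^^ (k - 1)) x"

section \<open>The tensor model\<close>

definition kron :: "complex mat \<Rightarrow> complex mat \<Rightarrow> complex mat" where
  "kron A B = mat (dim_row A * dim_row B) (dim_col A * dim_col B)
     (\<lambda>(i, j). A $$ (i div dim_row B, j div dim_col B) * B $$ (i mod dim_row B, j mod dim_col B))"

definition kron_list :: "complex mat list \<Rightarrow> complex mat" where
  "kron_list As = foldr kron As (1\<^sub>m 1)"

definition J_mat :: "complex mat" where
  "J_mat = mat_of_rows_list 2 [[0, 1], [1, 0]]"

definition E11_mat :: "complex mat" where
  "E11_mat = mat_of_rows_list 2 [[1, 0], [0, 0]]"

definition B_mat :: "nat \<Rightarrow> nat \<Rightarrow> complex mat" where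
  "B_mat q i = (if i = 0 then 1\<^sub>m (2 ^ q)
     else kron_list (map (\<lambda>s. if s = i then J_mat else 1\<^sub>m 2) [1..<Suc q]))"

text \<open>An elementary tensor \<open>a \<otimes> B\<close> of an \<open>n \<times> n\<close> matrix \<open>a\<close> and a \<open>2^q \<times> 2^q\<close> matrix \<open>B\<close> is read as
  the \<open>2^q \<times> 2^q\<close> block matrix with blocks \<open>B $$ (s, t) \<cdot> a\<close>. With the usual index convention of the
  Kronecker product this is \<open>kron B a\<close>, with the factors exchanged.\<close>

definition block_tensor :: "complex mat \<Rightarrow> complex mat \<Rightarrow> complex mat" where
  "block_tensor a B = kron B a"

definition b_tilde :: "nat \<Rightarrow> nat \<Rightarrow> nat \<Rightarrow> minf" where
  "b_tilde q n i = mat_embed (block_tensor (1\<^sub>m n) (B_mat q i))"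

definition phi :: "nat \<Rightarrow> nat \<Rightarrow> minf \<Rightarrow> minf" where
  "phi q n a = mat_embed (block_tensor (corner n a) (kron_list (replicate q E11_mat)))"

definition P_tilde ::
  "nat \<Rightarrow> nat \<Rightarrow> (nat \<Rightarrow> nat \<Rightarrow> nat \<Rightarrow> complex) \<Rightarrow> (nat \<Rightarrow> minf) \<Rightarrow> nat \<Rightarrow> minf" where
  "P_tilde p q lam a n = (\<Sum>i1\<in>{0..q}. \<Sum>i2\<in>{0..q}. \<Sum>j\<in>{1..p}.
     lam i1 i2 j *\<^sub>C (b_tilde q n i1 * phi q n (a j) * b_tilde q n i2))"

section \<open>Alternating monomials\<close>

datatype letter = LA nat | LB nat

fun is_LA :: "letter \<Rightarrow> bool" where
  "is_LA (LA i) = True"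
| "is_LA (LB j) = False"

fun letter_val :: "(nat \<Rightarrow> 'a) \<Rightarrow> (nat \<Rightarrow> 'a) \<Rightarrow> letter \<Rightarrow> 'a" where
  "letter_val a b (LA i) = a i"
| "letter_val a b (LB j) = b j"

definition alternating :: "nat \<Rightarrow> nat \<Rightarrow> letter list \<Rightarrow> bool" where
  "alternating p q w \<longleftrightarrow> set w \<subseteq> LA ` {1..p} \<union> LB ` {1..q}
     \<and> successively (\<lambda>x y. is_LA x \<noteq> is_LA y) w"

definition alternating_monomials ::
  "nat \<Rightarrow> nat \<Rightarrow> nat \<Rightarrow> (nat \<Rightarrow> 'a::monoid_mult) \<Rightarrow> (nat \<Rightarrow> 'a) \<Rightarrow> 'a set" where
  "alternating_monomials m p q a b =
     {prod_list (map (letter_val a b) w) | w. alternating p q w \<and> m \<le> length (filter is_LA w)}"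

section \<open>The encodings agree with the matrix algebras\<close>

lemma entry_mat_embed:
  "entry (mat_embed A) i j = (if i < dim_row A \<and> j < dim_col A then A $$ (i, j) else 0)"
  by (simp add: mat_embed.rep_eq)

lemma corner_mat_embed: "A \<in> carrier_mat n n \<Longrightarrow> corner n (mat_embed A) = A"
  by (rule eq_matI) (auto simp: corner_def entry_mat_embed)

lemma mem_M_corner_iff: "x \<in> M_corner n \<longleftrightarrow> (\<forall>i j. n \<le> i \<or> n \<le> j \<longrightarrow> entry x i j = 0)"
proof
  assume "\<forall>i j. n \<le> i \<or> n \<le> j \<longrightarrow> entry x i j = 0"
  then have "x = mat_embed (corner n x)"
    by (intro minf_eqI) (auto simp: corner_def entry_mat_embed)
  then show "x \<in> M_corner n" by (auto simp: M_corner_def corner_def)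
qed (auto simp: M_corner_def entry_mat_embed)

lemma Union_M_corner: "(\<Union>n. M_corner n) = UNIV"
proof -
  have "\<exists>n. x \<in> M_corner n" for x by (rule entry_bound[of x]) (auto simp: mem_M_corner_iff)
  then show ?thesis by auto
qed

lemma mat_embed_mult:
  assumes "A \<in> carrier_mat n n" "B \<in> carrier_mat n n"
  shows "mat_embed (A * B) = mat_embed A * mat_embed B"
proof (rule minf_eqI)
  fix i j
  have "entry (mat_embed A * mat_embed B) i j
      = (\<Sum>k<n. entry (mat_embed A) i k * entry (mat_embed B) k j)"
    by (rule entry_times_bound) (use assms in \<open>auto simp: entry_mat_embed\<close>)
  then show "entry (mat_embed (A * B)) i j = entry (mat_embed A * mat_embed B) i j"
    using assms by (auto simp: entry_mat_embed scalar_prod_def atLeast0LessThan intro!: sum.cong)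
qed

lemma mat_embed_four_block:
  assumes "A \<in> carrier_mat n n"
  shows "mat_embed (four_block_mat A (0\<^sub>m n m) (0\<^sub>m m n) (0\<^sub>m m m)) = mat_embed A"
  using assms by (intro minf_eqI) (auto simp: entry_mat_embed)

lemma Tr_mat_embed: "A \<in> carrier_mat n n \<Longrightarrow> Tr (mat_embed A) = (\<Sum>i<n. A $$ (i, i))"
  unfolding Tr_def
  by (rule sum.mono_neutral_cong_left) (auto simp: entry_mat_embed split: if_splits)

lemma kron_list_E11:
  "kron_list (replicate q E11_mat) = mat (2 ^ q) (2 ^ q) (\<lambda>(i, j). if i = 0 \<and> j = 0 then 1 else 0)"
proof (induction q)
  case 0
  show ?case by (rule eq_matI) (auto simp: kron_list_def)
next
  case (Suc q)
  have "kron_list (replicate (Suc q) E11_mat) = kron E11_mat (kron_list (replicate q E11_mat))"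
    by (simp add: kron_list_def)
  also have "\<dots> = mat (2 ^ Suc q) (2 ^ Suc q) (\<lambda>(i, j). if i = 0 \<and> j = 0 then 1 else 0)"
  proof (rule eq_matI, goal_cases)
    case (1 i j)
    then have ij: "i div 2 ^ q < 2" "j div 2 ^ q < 2"
      by (auto simp: less_mult_imp_div_less)
    have E: "E11_mat $$ (r, s) = (if r = 0 \<and> s = 0 then 1 else 0)" if "r < 2" "s < 2" for r s
      using that by (auto simp: E11_mat_def mat_of_rows_list_def less_2_cases_iff)
    have z: "m = 0 \<longleftrightarrow> m div 2 ^ q = 0 \<and> m mod 2 ^ q = 0" for m :: nat
      by (metis div_0 mod_0 div_mult_mod_eq mult_0 add_0)
    show ?case using 1 ij
      by (simp add: kron_def Suc.IH E z[of i] z[of j] E11_mat_def[THEN arg_cong, of dim_row]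
          E11_mat_def[THEN arg_cong, of dim_col] mat_of_rows_list_def del: div_eq_0_iff)
  qed (simp_all add: kron_def Suc.IH, simp_all add: E11_mat_def mat_of_rows_list_def)
  finally show ?case .
qed

lemma phi_M_corner:
  assumes "x \<in> M_corner n"
  shows "phi q n x = x"
proof (cases "n = 0")
  case True
  with assms show ?thesis
    by (intro minf_eqI) (auto simp: phi_def block_tensor_def kron_def corner_def entry_mat_embed
        mem_M_corner_iff)
next
  case False
  have "i < 2 ^ q * n" if "i < n" for i
    by (rule less_le_trans[OF that]) simp
  with assms False show ?thesis
    by (intro minf_eqI) (auto simp: phi_def block_tensor_def kron_def corner_def entry_mat_embed
        kron_list_E11 mem_M_corner_iff div_eq_0_iff less_mult_imp_div_less)
qed

end

theory Submission
  imports Defs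
begin

text \<open>
  Why the theorem holds. Collect the coefficients of the linear part of \<open>P\<close> into a
  \<open>(q+1) \<times> (q+1)\<close> matrix \<open>x\<close> with entries \<open>x i j = (\<Sum>s. lam i j s *\<^sub>C a s)\<close> in \<open>M\<^sub>\<infinity>(\<complex>)\<close>. Then
  \<open>P = (\<Sum>i j. b i * \<iota> (x i j) * b j) + R\<close>, and the tensor model is the same expression, without
  remainder, in the matrices \<open>b_tilde\<close>. In both algebras the adjacent factors \<open>b r * b s\<close> that arise
  when such sums are multiplied may be replaced by the scalar \<open>\<delta>\<^sub>r\<^sub>s\<close>, so that the powers are governed
  by the powers of the matrix \<open>x\<close>; this is \<open>sandwich_power\<close>, which serves both sides.

  In \<open>\<C>\<close> the replacement is valid modulo the span \<open>N\<close> of the words having an interior factor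
  \<open>c \<in> B\<close> with \<open>\<tau> c = 0\<close>: indeed \<open>b r * b s - \<delta>\<^sub>r\<^sub>s\<close> is such a \<open>c\<close> by orthonormality. Either kind of
  independence makes the functional vanish on \<open>N\<close>. Moreover \<open>N\<close> absorbs multiplication by \<open>A\<close> and \<open>B\<close>
  from both sides, and it contains \<open>R\<close>, because a monomial with two \<open>a\<close>'s contains a factor
  \<open>a * b j * a'\<close> with \<open>j \<noteq> 0\<close>. Hence the functional only sees the terms \<open>b i * \<iota> (X i j) * b j\<close>,
  where \<open>X\<close> is the \<open>k\<close>-th power of \<open>x\<close>. It sends such a term to \<open>\<delta>\<^sub>i\<^sub>j Tr (X i j)\<close> in the cyclic case,
  as \<open>\<tau> (b j * b i) = \<delta>\<^sub>i\<^sub>j\<close>, and to \<open>\<delta>\<^sub>i\<^sub>0 \<delta>\<^sub>j\<^sub>0 Tr (X i j)\<close> in the monotone case, as \<open>\<tau> (b i) = \<delta>\<^sub>i\<^sub>0\<close>.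

  In the tensor model let \<open>e\<close> be the unit of the upper left \<open>n \<times> n\<close> corner. The matrices \<open>b_tilde\<close>
  flip tensor factors and so move the first block to pairwise different blocks, which gives
  \<open>e * b_tilde r * b_tilde s * e = \<delta>\<^sub>r\<^sub>s e\<close> and \<open>e * b_tilde r * e = \<delta>\<^sub>r\<^sub>0 e\<close>: compression to the corner
  plays the part of \<open>\<tau>\<close>. The replacement above is then exact, since the entries of \<open>x\<close> are fixed by
  \<open>e\<close>. For \<open>l \<ge> 2\<^sup>q n\<close> the functional \<open>eta l\<close> is the full trace on the corner in question, and its
  cyclicity brings \<open>b_tilde j * b_tilde i\<close> between two copies of \<open>e\<close> (\<open>eta_sandwich_large\<close>). For
  \<open>l \<le> n\<close> it only sees the compression by \<open>e\<close>, and only the term with \<open>i = j = 0\<close> survives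
  (\<open>eta_sandwich_small\<close>). These are the two formulas above, and every limit is that of an eventually
  constant sequence; in the monotone case the inner limit is \<open>eta l (X 0 0)\<close>, which equals
  \<open>Tr (X 0 0)\<close> for large \<open>l\<close>.
\<close>

section \<open>Powers of sums of sandwiched matrix entries\<close>

lemma sum_closed:
  assumes "0 \<in> N" "\<And>u v. u \<in> N \<Longrightarrow> v \<in> N \<Longrightarrow> u + v \<in> N" "\<And>i. i \<in> S \<Longrightarrow> g i \<in> N"
  shows "(\<Sum>i\<in>S. g i) \<in> N"
  using assms(3) by (induction S rule: infinite_finite_induct) (auto simp: assms(1,2))

text \<open>The \<open>(m+1)\<close>-st power of the matrix \<open>(x i j)\<close> with indices \<open>0, \<dots>, q\<close>. The exponent is shifted
  because the algebra of the entries need not have a unit, so there is no zeroth power.\<close>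

fun matrix_power_Suc :: "nat \<Rightarrow> (nat \<Rightarrow> nat \<Rightarrow> 'a::semiring_0) \<Rightarrow> nat \<Rightarrow> nat \<Rightarrow> nat \<Rightarrow> 'a" where
  "matrix_power_Suc q x 0 i j = x i j"
| "matrix_power_Suc q x (Suc m) i j = (\<Sum>r\<in>{0..q}. x i r * matrix_power_Suc q x m r j)"

definition sandwich :: "nat \<Rightarrow> (nat \<Rightarrow> 'r::ring) \<Rightarrow> ('s \<Rightarrow> 'r) \<Rightarrow> (nat \<Rightarrow> nat \<Rightarrow> 's) \<Rightarrow> 'r" where
  "sandwich q b f x = (\<Sum>i\<in>{0..q}. \<Sum>j\<in>{0..q}. b i * f (x i j) * b j)"

text \<open>Multiplying out gives terms indexed by \<open>i, r, s, j\<close>. Merging each of them modulo \<open>N\<close> kills those with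
  \<open>r \<noteq> s\<close>, and the rest add up to the matrix product.\<close>

lemma sandwich_mult:
  fixes b :: "nat \<Rightarrow> 'r::ring" and f :: "'s::ring \<Rightarrow> 'r"
  assumes f: "\<And>x y. f (x + y) = f x + f y"
    and N0: "0 \<in> N" and Nadd: "\<And>u v. u \<in> N \<Longrightarrow> v \<in> N \<Longrightarrow> u + v \<in> N"
    and merge: "\<And>i r s j. i \<le> q \<Longrightarrow> r \<le> q \<Longrightarrow> s \<le> q \<Longrightarrow> j \<le> q \<Longrightarrow>
      (b i * f (x i r) * b r) * (b s * f (y s j) * b j)
        - (if r = s then b i * f (x i r * y s j) * b j else 0) \<in> N"
  shows "sandwich q b f x * sandwich q b f y
    - sandwich q b f (\<lambda>i j. \<Sum>r\<in>{0..q}. x i r * y r j) \<in> N"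
proof -
  have f0: "f 0 = 0" using f[of 0 0] by simp
  have fsum: "f (\<Sum>r\<in>{0..q}. g r) = (\<Sum>r\<in>{0..q}. f (g r))" for g
    using f f0 by (intro sum_comp_morphism[symmetric, unfolded o_def]) auto
  have Nsum: "(\<Sum>r\<in>{0..q}. g r) \<in> N" if "\<And>r. r \<le> q \<Longrightarrow> g r \<in> N" for g
    using that N0 Nadd by (intro sum_closed) auto
  let ?d = "\<lambda>i r s j. (if r = s then b i * f (x i r * y s j) * b j else 0)"
  have "sandwich q b f x * sandwich q b f y
    = (\<Sum>i\<in>{0..q}. \<Sum>r\<in>{0..q}. \<Sum>s\<in>{0..q}. \<Sum>j\<in>{0..q}.
        (b i * f (x i r) * b r) * (b s * f (y s j) * b j))"
    unfolding sandwich_def by (simp only: sum_distrib_right, simp only: sum_distrib_left)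
  moreover have "sandwich q b f (\<lambda>i j. \<Sum>r\<in>{0..q}. x i r * y r j)
    = (\<Sum>i\<in>{0..q}. \<Sum>r\<in>{0..q}. \<Sum>s\<in>{0..q}. \<Sum>j\<in>{0..q}. ?d i r s j)"
  proof -
    have diagonal: "(\<Sum>s\<in>{0..q}. \<Sum>j\<in>{0..q}. ?d i r s j) = (\<Sum>j\<in>{0..q}. b i * f (x i r * y r j) * b j)"
      if "r \<in> {0..q}" for i r
      using that by (subst sum.swap) (simp add: sum.delta)
    have "(\<Sum>r\<in>{0..q}. \<Sum>s\<in>{0..q}. \<Sum>j\<in>{0..q}. ?d i r s j)
        = (\<Sum>r\<in>{0..q}. \<Sum>j\<in>{0..q}. b i * f (x i r * y r j) * b j)" for i
      by (rule sum.cong[OF refl diagonal])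
    also have "(\<Sum>r\<in>{0..q}. \<Sum>j\<in>{0..q}. b i * f (x i r * y r j) * b j)
        = (\<Sum>j\<in>{0..q}. \<Sum>r\<in>{0..q}. b i * f (x i r * y r j) * b j)" for i
      by (rule sum.swap)
    also have "(\<Sum>j\<in>{0..q}. \<Sum>r\<in>{0..q}. b i * f (x i r * y r j) * b j)
        = (\<Sum>j\<in>{0..q}. b i * f (\<Sum>r\<in>{0..q}. x i r * y r j) * b j)" for i
      by (simp only: fsum sum_distrib_left sum_distrib_right)
    finally show ?thesis
      unfolding sandwich_def by simp
  qed
  ultimately have "sandwich q b f x * sandwich q b f y
      - sandwich q b f (\<lambda>i j. \<Sum>r\<in>{0..q}. x i r * y r j)
    = (\<Sum>i\<in>{0..q}. \<Sum>r\<in>{0..q}. \<Sum>s\<in>{0..q}. \<Sum>j\<in>{0..q}.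
        (b i * f (x i r) * b r) * (b s * f (y s j) * b j) - ?d i r s j)"
    by (simp only: sum_subtractf)
  also have "\<dots> \<in> N"
    by (intro Nsum merge)
  finally show ?thesis .
qed

text \<open>Induction on \<open>m\<close>: with \<open>S\<^sub>m\<close> the sandwich of the \<open>m\<close>-th matrix power,
  \<open>P * P\<^sup>m - S\<^sub>m\<^sub>+\<^sub>1 = (S\<^sub>1 * S\<^sub>m - S\<^sub>m\<^sub>+\<^sub>1) + R * S\<^sub>m + P * (P\<^sup>m - S\<^sub>m)\<close>, and each summand lies in \<open>N\<close>.
  The power of \<open>P\<close> is written as an iterated product and \<open>f\<close> and \<open>N\<close> are left abstract because the
  lemma is applied to a unital algebra with a proper error space \<open>N\<close> and also to the non-unital
  algebra of matrices with \<open>N = {0}\<close>, where merging is exact only for entries in one corner \<open>M\<close>.\<close>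

lemma sandwich_power:
  fixes b :: "nat \<Rightarrow> 'r::ring" and f :: "'s::ring \<Rightarrow> 'r"
  assumes f: "\<And>x y. f (x + y) = f x + f y"
    and N0: "0 \<in> N" and Nadd: "\<And>u v. u \<in> N \<Longrightarrow> v \<in> N \<Longrightarrow> u + v \<in> N"
    and M0: "0 \<in> M" and Madd: "\<And>u v. u \<in> M \<Longrightarrow> v \<in> M \<Longrightarrow> u + v \<in> M"
    and Mmult: "\<And>u v. u \<in> M \<Longrightarrow> v \<in> M \<Longrightarrow> u * v \<in> M"
    and xM: "\<And>i j. x i j \<in> M"
    and merge: "\<And>u v i r s j. u \<in> M \<Longrightarrow> v \<in> M \<Longrightarrow> i \<le> q \<Longrightarrow> r \<le> q \<Longrightarrow> s \<le> q \<Longrightarrow> j \<le> q \<Longrightarrow>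
      (b i * f u * b r) * (b s * f v * b j) - (if r = s then b i * f (u * v) * b j else 0) \<in> N"
    and P: "P = sandwich q b f x + R" and R: "R \<in> N"
    and RN: "\<And>u i j. u \<in> M \<Longrightarrow> i \<le> q \<Longrightarrow> j \<le> q \<Longrightarrow> R * (b i * f u * b j) \<in> N"
    and PN: "\<And>z. z \<in> N \<Longrightarrow> P * z \<in> N"
  shows "((*) P ^^ m) P - sandwich q b f (matrix_power_Suc q x m) \<in> N"
proof (induction m)
  case 0
  have "matrix_power_Suc q x 0 = x" by (intro ext) simp
  then show ?case using P R by simp
next
  case (Suc m)
  let ?y = "matrix_power_Suc q x m"
  have yM: "matrix_power_Suc q x m i j \<in> M" for m i j
    by (induction m arbitrary: i j) (auto simp: xM intro!: sum_closed M0 Madd Mmult)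
  have "sandwich q b f x * sandwich q b f ?y
      - sandwich q b f (\<lambda>i j. \<Sum>r\<in>{0..q}. x i r * ?y r j) \<in> N"
    by (intro sandwich_mult f N0 Nadd merge xM yM)
  moreover have "(\<lambda>i j. \<Sum>r\<in>{0..q}. x i r * ?y r j) = matrix_power_Suc q x (Suc m)"
    by (intro ext) simp
  moreover have "R * sandwich q b f ?y \<in> N"
    unfolding sandwich_def sum_distrib_left
    by (intro sum_closed N0 Nadd RN yM) auto
  moreover have "P * (((*) P ^^ m) P - sandwich q b f ?y) \<in> N"
    by (intro PN Suc.IH)
  moreover have "((*) P ^^ Suc m) P - sandwich q b f (matrix_power_Suc q x (Suc m))
    = (sandwich q b f x * sandwich q b f ?y - sandwich q b f (matrix_power_Suc q x (Suc m)))
      + R * sandwich q b f ?y + P * (((*) P ^^ m) P - sandwich q b f ?y)"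
    by (simp add: P distrib_right right_diff_distrib)
  ultimately show ?case by (simp only: Nadd)
qed

section \<open>Words with a centred interior factor\<close>

text \<open>The span of these words is the error space \<open>N\<close>. Only interior positions \<open>1 \<le> i < n\<close> count: in the
  cyclic case the outer factors \<open>b 0\<close> and \<open>b n\<close> enter through \<open>\<tau> (b n * b 0)\<close> only, so centring one of
  them would not make the value of the word vanish.\<close>

definition centred_words :: "('a::star_algebra_1 \<Rightarrow> complex) \<Rightarrow> 'a set \<Rightarrow> 'a set \<Rightarrow> 'a set" where
  "centred_words \<tau> A B = {word_prod n a b | n a b. (\<forall>i\<in>{1..n}. a i \<in> A) \<and> (\<forall>i\<in>{0..n}. b i \<in> B)
     \<and> (\<exists>i\<in>{1..<n}. \<tau> (b i) = 0)}"

lemma centred_wordsI: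
  assumes "\<And>i. i \<in> {1..n} \<Longrightarrow> a i \<in> A" "\<And>i. i \<in> {0..n} \<Longrightarrow> b i \<in> B" "i \<in> {1..<n}" "\<tau> (b i) = 0"
  shows "word_prod n a b \<in> centred_words \<tau> A B"
  using assms unfolding centred_words_def by blast

lemma word_prod_cong:
  assumes "\<And>i. i \<in> {1..n} \<Longrightarrow> a i = a' i" "\<And>i. i \<in> {0..n} \<Longrightarrow> b i = b' i"
  shows "word_prod n a b = word_prod n a' b'"
proof -
  have "map (\<lambda>i. a i * b i) [1..<Suc n] = map (\<lambda>i. a' i * b' i) [1..<Suc n]"
    using assms by (intro map_cong) auto
  moreover have "b 0 = b' 0" using assms by simp
  ultimately show ?thesis unfolding word_prod_def by (simp only:)
qed

lemma word_prod_Suc: "word_prod (Suc n) a b = word_prod n a b * (a (Suc n) * b (Suc n))"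
  by (simp add: word_prod_def mult.assoc)

lemma word_prod_left_B: "c * word_prod n a b = word_prod n a (b(0 := c * b 0))"
proof -
  have *: "map (\<lambda>i. a i * (b(0 := c * b 0)) i) [1..<Suc n] = map (\<lambda>i. a i * b i) [1..<Suc n]"
    by (intro map_cong) auto
  show ?thesis unfolding word_prod_def * by (simp add: mult.assoc)
qed

text \<open>The new letter becomes \<open>a\<^sub>1\<close>, preceded by \<open>b\<^sub>0 = 1\<close>, and all other letters move up by one index. The
  letter \<open>a\<^sub>0\<close> does not occur in a word, so its value is arbitrary.\<close>

lemma word_prod_left_A:
  "c * word_prod n a b = word_prod (Suc n) (case_nat undefined (\<lambda>i. if i = 0 then c else a i)) (case_nat 1 b)"
proof (induction n)
  case 0
  show ?case by (simp add: word_prod_def)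
next
  case (Suc n)
  then show ?case
    by (simp add: word_prod_Suc[of "Suc n"] word_prod_Suc[of n a b] mult.assoc[symmetric])
qed

lemma word_prod_right_B: "1 \<le> n \<Longrightarrow> word_prod n a b * c = word_prod n a (b(n := b n * c))"
proof -
  assume "1 \<le> n"
  then obtain m where n: "n = Suc m" by (cases n) auto
  have "word_prod m a (b(n := b n * c)) = word_prod m a b"
    by (intro word_prod_cong) (auto simp: n)
  then show ?thesis by (simp add: n word_prod_Suc mult.assoc)
qed

lemma word_prod_right_A: "word_prod n a b * c = word_prod (Suc n) (a(Suc n := c)) (b(Suc n := 1))"
proof -
  have "word_prod n (a(Suc n := c)) (b(Suc n := 1)) = word_prod n a b"
    by (intro word_prod_cong) auto
  then show ?thesis by (simp add: word_prod_Suc)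
qed

lemma cspan_mult_left:
  assumes "\<And>g. g \<in> G \<Longrightarrow> c * g \<in> cspan H" "x \<in> cspan G"
  shows "c * x \<in> cspan H"
  using assms(2)
proof (induction rule: complex_space.span_induct_alt)
  case base
  show ?case by (simp add: complex_space.span_zero)
next
  case (step r g y)
  then show ?case
    using assms(1) by (simp add: distrib_left mult_scaleC_right complex_space.span_add complex_space.span_scale)
qed

lemma cspan_mult_right:
  assumes "\<And>g. g \<in> G \<Longrightarrow> g * c \<in> cspan H" "x \<in> cspan G"
  shows "x * c \<in> cspan H"
  using assms(2)
proof (induction rule: complex_space.span_induct_alt)
  case base
  show ?case by (simp add: complex_space.span_zero)
next
  case (step r g y)
  then show ?case
    using assms(1) by (simp add: distrib_right mult_scaleC_left complex_space.span_add complex_space.span_scale)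
qed

text \<open>Multiplication by an element of \<open>B\<close> only changes an outer factor, and multiplication by an element
  of \<open>A\<close> lengthens the word. In both cases the centred factor remains in the interior.\<close>

lemma cspan_centred_words_absorb:
  assumes subB: "star_subalgebra B" and one: "1 \<in> B" and c: "c \<in> A \<union> B"
    and z: "z \<in> cspan (centred_words \<tau> A B)"
  shows "c * z \<in> cspan (centred_words \<tau> A B)" "z * c \<in> cspan (centred_words \<tau> A B)"
proof -
  have multB: "x * y \<in> B" if "x \<in> B" "y \<in> B" for x y
    using subB that by (auto simp: star_subalgebra_def)
  have "c * g \<in> centred_words \<tau> A B \<and> g * c \<in> centred_words \<tau> A B"
    if "g \<in> centred_words \<tau> A B" for g
  proof -
    from that obtain n a b i where g: "g = word_prod n a b"
      and a: "\<And>i. i \<in> {1..n} \<Longrightarrow> a i \<in> A" and b: "\<And>i. i \<in> {0..n} \<Longrightarrow> b i \<in> B"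
      and i: "i \<in> {1..<n}" "\<tau> (b i) = 0"
      unfolding centred_words_def by blast
    show ?thesis
    proof (cases "c \<in> B")
      case True
      have "c * g \<in> centred_words \<tau> A B"
        unfolding g word_prod_left_B
        by (rule centred_wordsI[where i = i]) (use a b i True multB in auto)
      moreover have "g * c = word_prod n a (b(n := b n * c))"
        unfolding g using i by (intro word_prod_right_B) auto
      then have "g * c \<in> centred_words \<tau> A B"
        using a b i True multB by (auto intro!: centred_wordsI[where i = i])
      ultimately show ?thesis ..
    next
      case False
      then have cA: "c \<in> A" using c by auto
      have "c * g \<in> centred_words \<tau> A B"
        unfolding g word_prod_left_A
        by (rule centred_wordsI[where i = "Suc i"])
          (use a b i cA one in \<open>auto split: nat.split\<close>)
      moreover have "g * c \<in> centred_words \<tau> A B"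
        unfolding g word_prod_right_A
        by (rule centred_wordsI[where i = i]) (use a b i cA one in auto)
      ultimately show ?thesis ..
    qed
  qed
  then have "c * g \<in> cspan (centred_words \<tau> A B)" "g * c \<in> cspan (centred_words \<tau> A B)"
    if "g \<in> centred_words \<tau> A B" for g
    using that complex_space.span_base by blast+
  then show "c * z \<in> cspan (centred_words \<tau> A B)" "z * c \<in> cspan (centred_words \<tau> A B)"
    using cspan_mult_left[OF _ z] cspan_mult_right[OF _ z] by blast+
qed

lemma cspan_centred_words_base:
  assumes "x \<in> A" "y \<in> A" "c \<in> B" "\<tau> c = 0" "1 \<in> B"
  shows "x * c * y \<in> cspan (centred_words \<tau> A B)"
proof (rule complex_space.span_base)
  have "x * c * y = word_prod 2 (\<lambda>i. if i = 1 then x else y) (\<lambda>i. if i = 1 then c else 1)"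
    by (simp add: word_prod_def numeral_2_eq_2 mult.assoc)
  also have "\<dots> \<in> centred_words \<tau> A B"
    by (rule centred_wordsI[where i = 1]) (use assms in auto)
  finally show "x * c * y \<in> centred_words \<tau> A B" .
qed

lemma centred_words_subset_ideal: "cspan (centred_words \<tau> A B) \<subseteq> ideal_over B A"
  unfolding ideal_over_def centred_words_def
  by (intro complex_space.span_mono) fastforce

lemma sandwich_in_ideal:
  assumes "x \<in> A" "c \<in> B" "d \<in> B"
  shows "c * x * d \<in> ideal_over B A"
  unfolding ideal_over_def
proof (rule complex_space.span_base)
  have "c * x * d = word_prod 1 (\<lambda>i. x) (\<lambda>i. if i = 0 then c else d)"
    by (simp add: word_prod_def mult.assoc)
  then show "c * x * d \<in> {word_prod n a b | n a b.
     1 \<le> n \<and> (\<forall>i\<in>{1..n}. a i \<in> A) \<and> (\<forall>i\<in>{0..n}. b i \<in> B)}"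
    by (intro CollectI exI conjI) (use assms in auto)
qed

lemma linear_functional_on_sum:
  assumes "linear_functional_on D \<omega>" "\<And>i. i \<in> S \<Longrightarrow> g i \<in> D"
  shows "(\<Sum>i\<in>S. g i) \<in> D \<and> \<omega> (\<Sum>i\<in>S. g i) = (\<Sum>i\<in>S. \<omega> (g i))"
proof -
  have D: "0 \<in> D" "\<And>x y. x \<in> D \<Longrightarrow> y \<in> D \<Longrightarrow> x + y \<in> D"
    and add: "\<And>x y. x \<in> D \<Longrightarrow> y \<in> D \<Longrightarrow> \<omega> (x + y) = \<omega> x + \<omega> y"
    using assms(1) by (auto simp: linear_functional_on_def star_subalgebra_def)
  have "\<omega> 0 = 0" using add[OF D(1) D(1)] by simp
  then show ?thesis
    using assms(2) by (induction S rule: infinite_finite_induct) (auto simp: D add)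
qed

lemma linear_functional_on_vanish:
  assumes \<omega>: "linear_functional_on D \<omega>" and GD: "G \<subseteq> D" and G0: "\<And>g. g \<in> G \<Longrightarrow> \<omega> g = 0"
    and x: "x \<in> cspan G"
  shows "\<omega> x = 0"
proof -
  have D: "0 \<in> D" "\<And>x y. x \<in> D \<Longrightarrow> y \<in> D \<Longrightarrow> x + y \<in> D" "\<And>r x. x \<in> D \<Longrightarrow> r *\<^sub>C x \<in> D"
    and add: "\<And>x y. x \<in> D \<Longrightarrow> y \<in> D \<Longrightarrow> \<omega> (x + y) = \<omega> x + \<omega> y"
    and scale: "\<And>r x. x \<in> D \<Longrightarrow> \<omega> (r *\<^sub>C x) = r * \<omega> x"
    using \<omega> by (auto simp: linear_functional_on_def star_subalgebra_def)
  have "x \<in> D \<and> \<omega> x = 0"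
    using x
  proof (induction rule: complex_space.span_induct_alt)
    case base
    show ?case using D(1) add[OF D(1) D(1)] by simp
  next
    case (step r g y)
    then show ?case using GD G0 D add scale by auto
  qed
  then show ?thesis ..
qed

text \<open>The values \<open>\<tau> (b i)\<close> of all interior factors occur in the product formula.\<close>

lemma cyclically_monotone_vanish:
  assumes cm: "cyclically_monotone A B \<tau> D \<omega>" and lin: "linear_functional_on D \<omega>"
    and z: "z \<in> cspan (centred_words \<tau> A B)"
  shows "\<omega> z = 0"
proof (rule linear_functional_on_vanish[OF lin _ _ z])
  show "centred_words \<tau> A B \<subseteq> D"
    using cm centred_words_subset_ideal complex_space.span_superset
    unfolding cyclically_monotone_def by blast
  fix g assume "g \<in> centred_words \<tau> A B"
  then obtain n a b i where g: "g = word_prod n a b"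
    and ab: "\<forall>i\<in>{1..n}. a i \<in> A" "\<forall>i\<in>{0..n}. b i \<in> B"
    and i: "i \<in> {1..<n}" "\<tau> (b i) = 0"
    unfolding centred_words_def by blast
  then have "(\<Prod>i\<in>{1..<n}. \<tau> (b i)) = 0" by auto
  moreover have "1 \<le> n" using i by auto
  ultimately show "\<omega> g = 0"
    using cm ab unfolding cyclically_monotone_def g by simp
qed

lemma monotone_indep_vanish:
  assumes mi: "monotone_indep A B \<tau> D \<omega>" and lin: "linear_functional_on D \<omega>"
    and z: "z \<in> cspan (centred_words \<tau> A B)"
  shows "\<omega> z = 0"
proof (rule linear_functional_on_vanish[OF lin _ _ z])
  show "centred_words \<tau> A B \<subseteq> D"
    using mi centred_words_subset_ideal complex_space.span_superset
    unfolding monotone_indep_def by blast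
  fix g assume "g \<in> centred_words \<tau> A B"
  then obtain n a b i where g: "g = word_prod n a b"
    and ab: "\<forall>i\<in>{1..n}. a i \<in> A" "\<forall>i\<in>{0..n}. b i \<in> B"
    and i: "i \<in> {1..<n}" "\<tau> (b i) = 0"
    unfolding centred_words_def by blast
  then have "(\<Prod>i\<in>{0..n}. \<tau> (b i)) = 0" by (intro prod_zero) auto
  moreover have "1 \<le> n" using i by auto
  ultimately show "\<omega> g = 0"
    using mi ab unfolding monotone_indep_def g by simp
qed

lemma cyclically_monotone_sandwich:
  assumes "cyclically_monotone A B \<tau> D \<omega>" "x \<in> A" "c \<in> B" "d \<in> B"
  shows "\<omega> (c * x * d) = \<omega> x * \<tau> (d * c)"
proof -
  let ?b = "\<lambda>i::nat. if i = 0 then c else d"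
  have "c * x * d = word_prod 1 (\<lambda>i. x) ?b"
    by (simp add: word_prod_def mult.assoc)
  moreover have "\<omega> (word_prod 1 (\<lambda>i. x) ?b) = \<omega> (prod_list (map (\<lambda>i. x) [1..<Suc 1]))
      * (\<Prod>i\<in>{1..<1}. \<tau> (?b i)) * \<tau> (?b 1 * ?b 0)"
    using assms unfolding cyclically_monotone_def by auto
  ultimately show ?thesis by simp
qed

lemma monotone_indep_sandwich:
  assumes "monotone_indep A B \<tau> D \<omega>" "x \<in> A" "c \<in> B" "d \<in> B"
  shows "\<omega> (c * x * d) = \<omega> x * (\<tau> c * \<tau> d)"
proof -
  let ?b = "\<lambda>i::nat. if i = 0 then c else d"
  have "c * x * d = word_prod 1 (\<lambda>i. x) ?b"
    by (simp add: word_prod_def mult.assoc)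
  moreover have "\<omega> (word_prod 1 (\<lambda>i. x) ?b) = \<omega> (prod_list (map (\<lambda>i. x) [1..<Suc 1]))
      * (\<Prod>i\<in>{0..1}. \<tau> (?b i))"
    using assms unfolding monotone_indep_def by auto
  moreover have "{0..1::nat} = {0, 1}" by auto
  ultimately show ?thesis by simp
qed

text \<open>If dropping the first letter leaves fewer than two \<open>a\<close>'s, then that letter is the first of exactly two
  \<open>a\<close>'s, and by alternation the second one stands two places further on.\<close>

lemma alternating_split:
  assumes "successively (\<lambda>x y. is_LA x \<noteq> is_LA y) w" "2 \<le> length (filter is_LA w)"
  shows "\<exists>u v i j i'. w = u @ [LA i, LB j, LA i'] @ v"
  using assms
proof (induction w)
  case Nil
  then show ?case by simp
next
  case (Cons x w)
  have succ: "successively (\<lambda>x y. is_LA x \<noteq> is_LA y) w"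
    using Cons.prems(1) by (cases w) auto
  show ?case
  proof (cases "2 \<le> length (filter is_LA w)")
    case True
    then obtain u v i j i' where "w = u @ [LA i, LB j, LA i'] @ v"
      using Cons.IH succ by blast
    then have "x # w = (x # u) @ [LA i, LB j, LA i'] @ v" by simp
    then show ?thesis by blast
  next
    case False
    then have x: "is_LA x" and w1: "filter is_LA w \<noteq> []"
      using Cons.prems(2) by (auto split: if_splits)
    then obtain y w' where w: "w = y # w'" by (cases w) auto
    then have y: "\<not> is_LA y" using Cons.prems(1) x by auto
    then obtain z w'' where w': "w' = z # w''" using w1 w by (cases w') auto
    then have z: "is_LA z" using succ w y by auto
    obtain i j i' where "x = LA i" "y = LB j" "z = LA i'"
      using x y z by (cases x; cases y; cases z) auto
    then have "x # w = [] @ [LA i, LB j, LA i'] @ w''" using w w' by simp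
    then show ?thesis by blast
  qed
qed

text \<open>The factor \<open>a i * b j * a i'\<close> of the monomial has the centred interior factor \<open>b j\<close>; the letters to its
  left and right are absorbed.\<close>

lemma alternating_monomials_centred:
  assumes subB: "star_subalgebra B" and one: "1 \<in> B"
    and a: "\<And>j. j \<in> {1..p} \<Longrightarrow> a j \<in> A"
    and b: "\<And>i. i \<in> {1..q} \<Longrightarrow> b i \<in> B \<and> \<tau> (b i) = 0"
  shows "alternating_monomials 2 p q a b \<subseteq> cspan (centred_words \<tau> A B)"
proof
  let ?N = "cspan (centred_words \<tau> A B)"
  note absorb = cspan_centred_words_absorb[OF subB one]
  fix z assume "z \<in> alternating_monomials 2 p q a b"
  then obtain w where z: "z = prod_list (map (letter_val a b) w)" and alt: "alternating p q w"
    and two: "2 \<le> length (filter is_LA w)"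
    unfolding alternating_monomials_def by blast
  obtain u v i j i' where w: "w = u @ [LA i, LB j, LA i'] @ v"
    using alternating_split[OF _ two] alt unfolding alternating_def by blast
  have letters: "set w \<subseteq> LA ` {1..p} \<union> LB ` {1..q}"
    using alt unfolding alternating_def by blast
  have val: "letter_val a b x \<in> A \<union> B" if "x \<in> set w" for x
  proof -
    have "x \<in> LA ` {1..p} \<union> LB ` {1..q}" using that letters by blast
    then show ?thesis using a b by auto
  qed
  have "a i \<in> A" "a i' \<in> A" "b j \<in> B" "\<tau> (b j) = 0"
    using letters w a b by auto
  then have core: "a i * b j * a i' \<in> ?N"
    using one by (intro cspan_centred_words_base)
  have right: "y * prod_list (map (letter_val a b) v') \<in> ?N" if "set v' \<subseteq> set w" "y \<in> ?N" for v' y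
    using that
  proof (induction v' arbitrary: y)
    case (Cons x v')
    have "y * letter_val a b x \<in> ?N"
      using Cons.prems val by (intro absorb) auto
    from Cons.IH[OF _ this] show ?case using Cons.prems by (simp add: mult.assoc)
  qed simp
  have left: "prod_list (map (letter_val a b) u') * y \<in> ?N" if "set u' \<subseteq> set w" "y \<in> ?N" for u' y
    using that
  proof (induction u')
    case (Cons x u')
    have "letter_val a b x * (prod_list (map (letter_val a b) u') * y) \<in> ?N"
      by (rule absorb(1)) (use Cons val in auto)
    then show ?case by (simp add: mult.assoc)
  qed simp
  have "z = prod_list (map (letter_val a b) u) * (a i * b j * a i' * prod_list (map (letter_val a b) v))"
    by (simp add: z w mult.assoc)
  also have "\<dots> \<in> ?N"
    by (intro left right core) (auto simp: w)
  finally show "z \<in> ?N" .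
qed

section \<open>The tensor model compressed to its upper left block\<close>

text \<open>The projection \<open>e\<close> onto the upper left block. It acts as a unit on \<open>M_corner n\<close>.\<close>

definition corner_unit :: "nat \<Rightarrow> minf" where
  "corner_unit n = mat_embed (1\<^sub>m n)"

fun binary_value :: "bool list \<Rightarrow> nat" where
  "binary_value [] = 0"
| "binary_value (d # ds) = (if d then 2 ^ length ds else 0) + binary_value ds"

lemma binary_value_less: "binary_value ds < 2 ^ length ds"
  by (induction ds) auto

lemma binary_value_inject:
  "length ds = length es \<Longrightarrow> binary_value ds = binary_value es \<Longrightarrow> ds = es"
proof (induction ds es rule: list_induct2)
  case (Cons d ds e es)
  then show ?case
    using binary_value_less[of ds] binary_value_less[of es] by (auto split: if_splits)
qed simp

text \<open>The block to which \<open>B_mat q i\<close> moves the first block. Flipping the \<open>i\<close>-th tensor factor sets the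
  \<open>i\<close>-th binary digit, counted from the most significant one, so this is \<open>2\<^bsup>q-i\<^esup>\<close> for
  \<open>1 \<le> i \<le> q\<close> and \<open>0\<close> for \<open>i = 0\<close>.\<close>

definition flip_index :: "nat \<Rightarrow> nat \<Rightarrow> nat" where
  "flip_index q i = binary_value (map (\<lambda>s. s = i) [1..<Suc q])"

lemma flip_index_less: "flip_index q i < 2 ^ q"
  using binary_value_less[of "map (\<lambda>s. s = i) [1..<Suc q]"]
  by (simp add: flip_index_def del: upt_Suc)

lemma flip_index_inject:
  assumes "i \<le> q" "j \<le> q"
  shows "flip_index q i = flip_index q j \<longleftrightarrow> i = j"
proof
  assume "flip_index q i = flip_index q j"
  then have *: "map (\<lambda>s. s = i) [1..<Suc q] = map (\<lambda>s. s = j) [1..<Suc q]"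
    unfolding flip_index_def by (intro binary_value_inject) auto
  then have "\<forall>s\<in>{1..q}. (s = i) = (s = j)"
    unfolding map_eq_conv by auto
  then show "i = j" using assms by (cases "i = 0"; cases "j = 0") auto
qed simp

lemma flip_index_0: "flip_index q 0 = 0"
proof -
  have "binary_value ds = 0" if "\<forall>d\<in>set ds. \<not> d" for ds
    using that by (induction ds) auto
  then show ?thesis by (simp add: flip_index_def)
qed

text \<open>The first row and column of \<open>J\<close> are the second unit vector and those of \<open>1\<^sub>m 2\<close> the first one.
  Kronecker products of unit vectors are unit vectors, and their positions combine as binary digits.\<close>

lemma kron_list_flip:
  fixes ds :: "bool list"
  defines "K \<equiv> kron_list (map (\<lambda>d. if d then J_mat else 1\<^sub>m 2) ds)"
  shows "K \<in> carrier_mat (2 ^ length ds) (2 ^ length ds)"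
    and "s < 2 ^ length ds \<Longrightarrow> K $$ (0, s) = (if s = binary_value ds then 1 else 0)"
    and "s < 2 ^ length ds \<Longrightarrow> K $$ (s, 0) = (if s = binary_value ds then 1 else 0)"
proof -
  have "K \<in> carrier_mat (2 ^ length ds) (2 ^ length ds) \<and> (\<forall>s < 2 ^ length ds.
     K $$ (0, s) = (if s = binary_value ds then 1 else 0) \<and>
     K $$ (s, 0) = (if s = binary_value ds then 1 else 0))"
    unfolding K_def
  proof (induction ds)
    case Nil
    show ?case by (simp add: kron_list_def)
  next
    case (Cons d ds)
    let ?D = "if d then J_mat else 1\<^sub>m 2 :: complex mat"
    let ?L = "kron_list (map (\<lambda>d. if d then J_mat else 1\<^sub>m 2) ds) :: complex mat"
    let ?n = "2 ^ length ds :: nat"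
    have D: "?D \<in> carrier_mat 2 2" by (auto simp: J_mat_def mat_of_rows_list_def)
    have L: "?L \<in> carrier_mat ?n ?n" using Cons.IH by blast
    have K: "kron_list (map (\<lambda>d. if d then J_mat else 1\<^sub>m 2) (d # ds)) = kron ?D ?L"
      by (simp add: kron_list_def)
    have Dv: "?D $$ (0, s) = (if s = (if d then 1 else 0) then 1 else 0)"
      "?D $$ (s, 0) = (if s = (if d then 1 else 0) then 1 else 0)" if "s < 2" for s
      using that by (auto simp: J_mat_def mat_of_rows_list_def less_2_cases_iff)
    have eq: "s = binary_value (d # ds) \<longleftrightarrow>
        s div ?n = (if d then 1 else 0) \<and> s mod ?n = binary_value ds" for s
    proof
      assume "s = binary_value (d # ds)"
      then show "s div ?n = (if d then 1 else 0) \<and> s mod ?n = binary_value ds"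
        using binary_value_less[of ds] by (auto simp: div_add1_eq)
    next
      assume "s div ?n = (if d then 1 else 0) \<and> s mod ?n = binary_value ds"
      then show "s = binary_value (d # ds)"
        using div_mult_mod_eq[of s ?n] by (auto split: if_splits)
    qed
    have "kron ?D ?L $$ (0, s) = (if s = binary_value (d # ds) then 1 else 0) \<and>
       kron ?D ?L $$ (s, 0) = (if s = binary_value (d # ds) then 1 else 0)" if "s < 2 * ?n" for s
    proof -
      have s: "s div ?n < 2" "s mod ?n < ?n" using that by (auto simp: less_mult_imp_div_less)
      have "kron ?D ?L $$ (0, s) = ?D $$ (0, s div ?n) * ?L $$ (0, s mod ?n)"
        "kron ?D ?L $$ (s, 0) = ?D $$ (s div ?n, 0) * ?L $$ (s mod ?n, 0)"
        using that D L unfolding kron_def by auto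
      then show ?thesis
        unfolding eq using Dv[OF s(1)] Cons.IH s(2) by auto
    qed
    moreover have "kron ?D ?L \<in> carrier_mat (2 * ?n) (2 * ?n)"
      using D L by (auto simp: kron_def)
    ultimately show ?case unfolding K by simp
  qed
  then show "K \<in> carrier_mat (2 ^ length ds) (2 ^ length ds)"
    "s < 2 ^ length ds \<Longrightarrow> K $$ (0, s) = (if s = binary_value ds then 1 else 0)"
    "s < 2 ^ length ds \<Longrightarrow> K $$ (s, 0) = (if s = binary_value ds then 1 else 0)"
    by auto
qed

lemma B_mat_border:
  shows "B_mat q i \<in> carrier_mat (2 ^ q) (2 ^ q)"
    and "s < 2 ^ q \<Longrightarrow> B_mat q i $$ (0, s) = (if s = flip_index q i then 1 else 0)"
    and "s < 2 ^ q \<Longrightarrow> B_mat q i $$ (s, 0) = (if s = flip_index q i then 1 else 0)"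
proof -
  have "B_mat q i \<in> carrier_mat (2 ^ q) (2 ^ q) \<and> (s < 2 ^ q \<longrightarrow>
    B_mat q i $$ (0, s) = (if s = flip_index q i then 1 else 0) \<and>
    B_mat q i $$ (s, 0) = (if s = flip_index q i then 1 else 0))"
  proof (cases "i = 0")
    case True
    then show ?thesis by (auto simp: B_mat_def flip_index_0)
  next
    case False
    have "B_mat q i = kron_list (map (\<lambda>d. if d then J_mat else 1\<^sub>m 2) (map (\<lambda>s. s = i) [1..<Suc q]))"
      using False by (simp add: B_mat_def o_def)
    then show ?thesis
      using kron_list_flip[where ds = "map (\<lambda>s. s = i) [1..<Suc q]"]
      by (auto simp: flip_index_def simp del: upt_Suc)
  qed
  then show "B_mat q i \<in> carrier_mat (2 ^ q) (2 ^ q)"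
    "s < 2 ^ q \<Longrightarrow> B_mat q i $$ (0, s) = (if s = flip_index q i then 1 else 0)"
    "s < 2 ^ q \<Longrightarrow> B_mat q i $$ (s, 0) = (if s = flip_index q i then 1 else 0)"
    by auto
qed

lemma b_tilde_M_corner: "b_tilde q n i \<in> M_corner (2 ^ q * n)"
  using B_mat_border(1)[of q i]
  by (auto simp: M_corner_def b_tilde_def block_tensor_def kron_def intro!: imageI)

text \<open>Row and column \<open>r < n\<close> belong to the first block, so they are determined by the first row and column
  of \<open>B_mat q i\<close>.\<close>

lemma b_tilde_border:
  assumes "r < n" "m < 2 ^ q * n"
  shows "entry (b_tilde q n i) r m = (if m = flip_index q i * n + r then 1 else 0)"
    and "entry (b_tilde q n i) m r = (if m = flip_index q i * n + r then 1 else 0)"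
proof -
  have n: "n > 0" using assms by auto
  have m: "m div n < 2 ^ q" "m mod n < n" using assms n by (auto simp: less_mult_imp_div_less)
  have r: "r < 2 ^ q * n" by (rule less_le_trans[OF assms(1)]) simp
  have eq: "m = flip_index q i * n + r \<longleftrightarrow> m div n = flip_index q i \<and> r = m mod n"
  proof
    assume "m div n = flip_index q i \<and> r = m mod n"
    then show "m = flip_index q i * n + r" by (metis div_mult_mod_eq)
  qed (use assms(1) in simp)
  show "entry (b_tilde q n i) r m = (if m = flip_index q i * n + r then 1 else 0)"
    "entry (b_tilde q n i) m r = (if m = flip_index q i * n + r then 1 else 0)"
    unfolding eq using assms n m r B_mat_border(1)[of q i] B_mat_border(2,3)[of "m div n" q i]
    by (auto simp: b_tilde_def block_tensor_def entry_mat_embed kron_def)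
qed

lemma M_corner_mono: "x \<in> M_corner n \<Longrightarrow> n \<le> m \<Longrightarrow> x \<in> M_corner m"
  by (auto simp: mem_M_corner_iff)

lemma M_corner_closed:
  shows "0 \<in> M_corner n"
    and "x \<in> M_corner n \<Longrightarrow> y \<in> M_corner n \<Longrightarrow> x + y \<in> M_corner n"
    and "x \<in> M_corner n \<Longrightarrow> y \<in> M_corner n \<Longrightarrow> x * y \<in> M_corner n"
    and "x \<in> M_corner n \<Longrightarrow> c *\<^sub>C x \<in> M_corner n"
  by (auto simp: mem_M_corner_iff zero_minf.rep_eq plus_minf.rep_eq scaleC_minf.rep_eq
      times_minf.rep_eq intro!: sum.neutral)

lemma entry_mult_left: "x \<in> M_corner n \<Longrightarrow> entry (x * y) i j = (\<Sum>k<n. entry x i k * entry y k j)"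
  by (rule entry_times_bound) (auto simp: mem_M_corner_iff)

lemma entry_mult_right:
  assumes "y \<in> M_corner n"
  shows "entry (x * y) i j = (\<Sum>k<n. entry x i k * entry y k j)"
proof -
  obtain m where x: "x \<in> M_corner m" using Union_M_corner by blast
  have "entry (x * y) i j = (\<Sum>k<max m n. entry x i k * entry y k j)"
    using M_corner_mono[OF x] by (intro entry_mult_left) auto
  also have "\<dots> = (\<Sum>k<n. entry x i k * entry y k j)"
    using assms by (intro sum.mono_neutral_right) (auto simp: mem_M_corner_iff)
  finally show ?thesis .
qed

lemma entry_corner_unit: "entry (corner_unit n) i j = (if i = j \<and> i < n then 1 else 0)"
  by (auto simp: corner_unit_def entry_mat_embed)

lemma corner_unit_M_corner: "corner_unit n \<in> M_corner n"
  by (auto simp: mem_M_corner_iff entry_corner_unit)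

lemma entry_corner_unit_mult:
  "entry (corner_unit n * z) i j = (if i < n then entry z i j else 0)"
  "entry (z * corner_unit n) i j = (if j < n then entry z i j else 0)"
proof -
  have "entry (corner_unit n * z) i j = (\<Sum>k<n. if k = i then entry z i j else 0)"
    unfolding entry_mult_left[OF corner_unit_M_corner] entry_corner_unit
    by (intro sum.cong) auto
  then show "entry (corner_unit n * z) i j = (if i < n then entry z i j else 0)" by simp
  have "entry (z * corner_unit n) i j = (\<Sum>k<n. if k = j then entry z i j else 0)"
    unfolding entry_mult_right[OF corner_unit_M_corner] entry_corner_unit
    by (intro sum.cong) auto
  then show "entry (z * corner_unit n) i j = (if j < n then entry z i j else 0)" by simp
qed

lemma corner_unit_mult:
  assumes "x \<in> M_corner n"
  shows "corner_unit n * x = x" "x * corner_unit n = x"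
  using assms by (auto intro!: minf_eqI simp: entry_corner_unit_mult mem_M_corner_iff)

text \<open>The analogue of \<open>\<tau> (b i) = \<delta>\<^sub>i\<^sub>0\<close>: for \<open>i \<noteq> 0\<close> the first block is moved away from itself.\<close>

lemma compress_b_tilde:
  assumes "i \<le> q"
  shows "corner_unit n * b_tilde q n i * corner_unit n = (if i = 0 then corner_unit n else 0)"
proof (rule minf_eqI)
  fix r c
  show "entry (corner_unit n * b_tilde q n i * corner_unit n) r c
      = entry (if i = 0 then corner_unit n else 0) r c"
  proof (cases "r < n \<and> c < n")
    case True
    then have "c < 2 ^ q * n" by (auto intro: order.strict_trans2[of c n])
    moreover have "flip_index q i = 0 \<longleftrightarrow> i = 0"
      using flip_index_inject[OF assms, of 0] by (simp add: flip_index_0)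
    moreover have "c \<noteq> flip_index q i * n + r" if "flip_index q i \<noteq> 0"
    proof -
      have "n \<le> flip_index q i * n" using that by (cases "flip_index q i") auto
      then show ?thesis using True by linarith
    qed
    ultimately show ?thesis
      using True b_tilde_border(1)[of r n c q i]
      by (auto simp: entry_corner_unit_mult entry_corner_unit zero_minf.rep_eq)
  qed (auto simp: entry_corner_unit_mult entry_corner_unit zero_minf.rep_eq)
qed

text \<open>The analogue of \<open>\<tau> (b i * b j) = \<delta>\<^sub>i\<^sub>j\<close>: the first block is moved to different blocks when
  \<open>i \<noteq> j\<close>, and moved back when the same flip is applied twice.\<close>

lemma compress_b_tilde_mult:
  assumes "i \<le> q" "j \<le> q"
  shows "corner_unit n * (b_tilde q n i * b_tilde q n j) * corner_unit n
    = (if i = j then corner_unit n else 0)"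
proof (rule minf_eqI)
  fix r c
  show "entry (corner_unit n * (b_tilde q n i * b_tilde q n j) * corner_unit n) r c
      = entry (if i = j then corner_unit n else 0) r c"
  proof (cases "r < n \<and> c < n")
    case True
    \<comment> \<open>The positions of the only nonzero entry in row \<open>r\<close> of the left factor and in column \<open>c\<close> of the right one.\<close>
    let ?s = "flip_index q i * n + r" and ?t = "flip_index q j * n + c"
    have "?s < Suc (flip_index q i) * n" using True by simp
    also have "\<dots> \<le> 2 ^ q * n" using flip_index_less[of q i] by (intro mult_right_mono) auto
    finally have s: "?s < 2 ^ q * n" .
    have st: "?s = ?t \<longleftrightarrow> i = j \<and> r = c"
    proof
      assume "?s = ?t"
      then have "?s div n = ?t div n" "?s mod n = ?t mod n" by simp_all
      then show "i = j \<and> r = c"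
        using True flip_index_inject[OF assms] by auto
    qed simp
    have "entry (b_tilde q n i * b_tilde q n j) r c
        = (\<Sum>m<2 ^ q * n. entry (b_tilde q n i) r m * entry (b_tilde q n j) m c)"
      by (intro entry_mult_left b_tilde_M_corner)
    also have "\<dots> = (\<Sum>m<2 ^ q * n. if m = ?s then (if ?s = ?t then 1 else 0) else 0)"
      using True by (intro sum.cong) (auto simp: b_tilde_border)
    also have "\<dots> = (if i = j \<and> r = c then 1 else 0)"
      using s st by simp
    finally show ?thesis
      using True by (auto simp: entry_corner_unit_mult entry_corner_unit zero_minf.rep_eq)
  qed (auto simp: entry_corner_unit_mult entry_corner_unit zero_minf.rep_eq)
qed

text \<open>As \<open>x\<close> and \<open>y\<close> live in the corner, they provide copies of \<open>e\<close> on both sides of \<open>z\<close>.\<close>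

lemma compress_sandwich:
  assumes z: "corner_unit n * z * corner_unit n = (if Q then corner_unit n else 0)"
    and x: "x \<in> M_corner n" and y: "y \<in> M_corner n"
  shows "x * z * y = (if Q then x * y else 0)"
proof -
  have "x * z * y = x * (corner_unit n * z * corner_unit n) * y"
    by (metis corner_unit_mult x y mult.assoc)
  then show ?thesis using z corner_unit_mult[OF x] by auto
qed

lemma eta_sum: "eta l (\<Sum>i\<in>S. g i) = (\<Sum>i\<in>S. eta l (g i))"
proof -
  have "eta l 0 = 0" "\<And>x y. eta l (x + y) = eta l x + eta l y"
    by (simp_all add: eta_def zero_minf.rep_eq plus_minf.rep_eq sum.distrib)
  then show ?thesis by (induction S rule: infinite_finite_induct) auto
qed

lemma eta_mult_commute:
  assumes "x \<in> M_corner l" "y \<in> M_corner l"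
  shows "eta l (x * y) = eta l (y * x)"
  unfolding eta_def entry_mult_left[OF assms(1)] entry_mult_left[OF assms(2)]
  by (subst sum.swap) (simp add: mult.commute)

lemma eta_eq_Tr: "x \<in> M_corner l \<Longrightarrow> eta l x = Tr x"
  unfolding Tr_def eta_def
  by (rule sum.mono_neutral_right) (auto simp: mem_M_corner_iff not_le[symmetric])

text \<open>All factors lie in the corner of size \<open>l\<close>, so \<open>eta l\<close> is cyclic on them. Writing \<open>x = x * e\<close>, two
  cyclic rotations bring \<open>b_tilde j * b_tilde i\<close> between \<open>e\<close> and \<open>x\<close>, where it compresses to
  \<open>\<delta>\<^sub>j\<^sub>i\<close>.\<close>

lemma eta_sandwich_large:
  assumes i: "i \<le> q" and j: "j \<le> q" and x: "x \<in> M_corner n" and l: "2 ^ q * n \<le> l"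
  shows "eta l (b_tilde q n i * x * b_tilde q n j) = (if i = j then Tr x else 0)"
proof -
  let ?b = "b_tilde q n" and ?e = "corner_unit n"
  have "n \<le> 2 ^ q * n" by simp
  then have nl: "n \<le> l" using l by linarith
  note corner = M_corner_mono[OF b_tilde_M_corner l] M_corner_mono[OF x nl]
    M_corner_mono[OF corner_unit_M_corner nl] M_corner_closed
  have "eta l (?b i * x * ?b j) = eta l (?b j * (?b i * x))"
    by (intro eta_mult_commute corner)
  also have "\<dots> = eta l ((?b j * ?b i * x) * ?e)"
    using corner_unit_mult[OF x] by (simp add: mult.assoc)
  also have "\<dots> = eta l (?e * (?b j * ?b i * x))"
    by (intro eta_mult_commute corner)
  also have "?e * (?b j * ?b i * x) = ?e * (?b j * ?b i) * x"
    by (simp add: mult.assoc)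
  also have "\<dots> = (if j = i then ?e * x else 0)"
    by (intro compress_sandwich[OF compress_b_tilde_mult] i j x corner_unit_M_corner)
  finally show ?thesis
    using corner_unit_mult[OF x] eta_eq_Tr[OF M_corner_mono[OF x nl]]
    by (auto simp: eta_def zero_minf.rep_eq)
qed

text \<open>The first \<open>l \<le> n\<close> diagonal entries do not change under compression by \<open>e\<close>, which turns the
  outer factors into the scalars \<open>\<delta>\<^sub>i\<^sub>0\<close> and \<open>\<delta>\<^sub>j\<^sub>0\<close>.\<close>

lemma eta_sandwich_small:
  assumes i: "i \<le> q" and j: "j \<le> q" and x: "x \<in> M_corner n" and l: "l \<le> n"
  shows "eta l (b_tilde q n i * x * b_tilde q n j) = (if i = 0 \<and> j = 0 then eta l x else 0)"
proof -
  let ?b = "b_tilde q n" and ?e = "corner_unit n"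
  have "eta l (?b i * x * ?b j) = eta l (?e * (?b i * x * ?b j) * ?e)"
    using l by (auto simp: eta_def entry_corner_unit_mult)
  also have "?e * (?b i * x * ?b j) * ?e = (?e * ?b i * x) * ?b j * ?e"
    by (simp add: mult.assoc)
  also have "?e * ?b i * x = (if i = 0 then ?e * x else 0)"
    by (intro compress_sandwich[OF compress_b_tilde] i x corner_unit_M_corner)
  also have "\<dots> = (if i = 0 then x else 0)"
    using corner_unit_mult[OF x] by simp
  also have "(if i = 0 then x else 0) * ?b j * ?e = (if j = 0 then (if i = 0 then x else 0) * ?e else 0)"
    by (intro compress_sandwich[OF compress_b_tilde] j corner_unit_M_corner) (auto simp: x M_corner_closed)
  finally show ?thesis
    using corner_unit_mult[OF x] by (auto simp: eta_def zero_minf.rep_eq)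
qed

section \<open>Comparison of the two expansions\<close>

text \<open>The case \<open>N = {0}\<close> and \<open>R = 0\<close> of \<open>sandwich_power\<close>; the embedding \<open>phi\<close> is the identity on the corner.\<close>

lemma P_tilde_power:
  fixes a :: "nat \<Rightarrow> minf" and lam :: "nat \<Rightarrow> nat \<Rightarrow> nat \<Rightarrow> complex"
  assumes a: "\<And>j. j \<in> {1..p} \<Longrightarrow> a j \<in> M_corner n"
  defines "x \<equiv> \<lambda>i j. \<Sum>s\<in>{1..p}. lam i j s *\<^sub>C a s"
  shows "minf_power (P_tilde p q lam a n) (Suc m)
      = sandwich q (b_tilde q n) (\<lambda>u. u) (matrix_power_Suc q x m)"
    and "matrix_power_Suc q x m i j \<in> M_corner n"
proof -
  have x: "x i j \<in> M_corner n" for i j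
    unfolding x_def by (intro sum_closed M_corner_closed a)
  show "matrix_power_Suc q x m i j \<in> M_corner n"
    by (induction m arbitrary: i j) (auto simp: x intro!: sum_closed M_corner_closed)
  have P: "P_tilde p q lam a n = sandwich q (b_tilde q n) (\<lambda>u. u) x + 0"
    unfolding P_tilde_def sandwich_def x_def
    by (simp add: phi_M_corner[OF a] sum_distrib_left sum_distrib_right mult_scaleC_left mult_scaleC_right)
  have "((*) (P_tilde p q lam a n) ^^ m) (P_tilde p q lam a n)
      - sandwich q (b_tilde q n) (\<lambda>u. u) (matrix_power_Suc q x m) \<in> {0}"
  proof (rule sandwich_power[where M = "M_corner n" and R = 0, OF _ _ _ _ _ _ x _ P])
    fix u v i r s j assume uv: "u \<in> M_corner n" "v \<in> M_corner n"
      and le: "i \<le> q" "r \<le> q" "s \<le> q" "j \<le> q"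
    have "u * (b_tilde q n r * b_tilde q n s) * v = (if r = s then u * v else 0)"
      by (intro compress_sandwich[OF compress_b_tilde_mult] le uv)
    then have "b_tilde q n i * (u * (b_tilde q n r * b_tilde q n s) * v) * b_tilde q n j
      = (if r = s then b_tilde q n i * (u * v) * b_tilde q n j else 0)" by simp
    then show "(b_tilde q n i * u * b_tilde q n r) * (b_tilde q n s * v * b_tilde q n j)
        - (if r = s then b_tilde q n i * (u * v) * b_tilde q n j else 0) \<in> {0}"
      by (simp add: mult.assoc)
  qed (auto simp: M_corner_closed)
  then show "minf_power (P_tilde p q lam a n) (Suc m)
      = sandwich q (b_tilde q n) (\<lambda>u. u) (matrix_power_Suc q x m)"
    by (simp add: minf_power_def)
qed

text \<open>The error space is \<open>N = cspan (centred_words \<tau> A B)\<close>. Since \<open>P\<close> is a combination of products of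
  letters from \<open>A\<close> and \<open>B\<close>, multiplication by \<open>P\<close> preserves \<open>N\<close>.\<close>

lemma power_mod_centred_words:
  fixes \<tau> :: "'c::star_algebra_1 \<Rightarrow> complex" and \<iota> :: "minf \<Rightarrow> 'c"
  assumes prob: "nc_probability_space \<tau>"
    and subB: "star_subalgebra B" and one: "1 \<in> B"
    and iota: "star_hom \<iota>" "range \<iota> = A"
    and bB: "\<And>i. i \<in> {0..q} \<Longrightarrow> b i \<in> B"
    and b_centred: "\<And>i. i \<in> {1..q} \<Longrightarrow> \<tau> (b i) = 0"
    and b_orthonormal: "\<And>i j. i \<in> {0..q} \<Longrightarrow> j \<in> {0..q} \<Longrightarrow> \<tau> (b i * b j) = (if i = j then 1 else 0)"
    and R: "R \<in> cspan (alternating_monomials 2 p q (\<lambda>j. \<iota> (a j)) b)"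
    and P: "P = sandwich q b \<iota> x + R"
  shows "P ^ Suc m - sandwich q b \<iota> (matrix_power_Suc q x m) \<in> cspan (centred_words \<tau> A B)"
proof -
  let ?N = "cspan (centred_words \<tau> A B)"
  note absorb = cspan_centred_words_absorb[OF subB one]
  have \<iota>A: "\<iota> u \<in> A" for u using iota by auto
  have \<iota>_add: "\<iota> (u + v) = \<iota> u + \<iota> v" and \<iota>_mult: "\<iota> (u * v) = \<iota> u * \<iota> v" for u v
    using iota unfolding star_hom_def by auto
  have sub: "alternating_monomials 2 p q (\<lambda>j. \<iota> (a j)) b \<subseteq> ?N"
    using subB one \<iota>A bB b_centred by (intro alternating_monomials_centred) auto
  have RN: "R \<in> ?N"
    using R complex_space.span_minimal[OF sub complex_space.subspace_span] by blast
  have left: "b i * \<iota> u * b j * z \<in> ?N" if "z \<in> ?N" "i \<le> q" "j \<le> q" for i j u z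
    unfolding mult.assoc using that bB \<iota>A by (intro absorb) auto
  have right: "z * (b i * \<iota> u * b j) \<in> ?N" if "z \<in> ?N" "i \<le> q" "j \<le> q" for i j u z
    unfolding mult.assoc[symmetric] using that bB \<iota>A by (intro absorb) auto
  have Rz: "R * z \<in> ?N" if z: "z \<in> ?N" for z
  proof (rule cspan_mult_right[OF _ R])
    fix g assume "g \<in> alternating_monomials 2 p q (\<lambda>j. \<iota> (a j)) b"
    then obtain w where g: "g = prod_list (map (letter_val (\<lambda>j. \<iota> (a j)) b) w)"
      and w: "set w \<subseteq> LA ` {1..p} \<union> LB ` {1..q}"
      unfolding alternating_monomials_def alternating_def by blast
    from w have "prod_list (map (letter_val (\<lambda>j. \<iota> (a j)) b) w) * z \<in> ?N"
    proof (induction w)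
      case (Cons y w)
      then have "y \<in> LA ` {1..p} \<union> LB ` {1..q}" by simp
      then have val: "letter_val (\<lambda>j. \<iota> (a j)) b y \<in> A \<union> B" using \<iota>A bB by auto
      have "letter_val (\<lambda>j. \<iota> (a j)) b y * (prod_list (map (letter_val (\<lambda>j. \<iota> (a j)) b) w) * z) \<in> ?N"
        by (rule absorb(1)) (use val Cons in auto)
      then show ?case by (simp add: mult.assoc)
    qed (simp add: z)
    then show "g * z \<in> ?N" using g by simp
  qed
  have "((*) P ^^ m) P - sandwich q b \<iota> (matrix_power_Suc q x m) \<in> ?N"
  proof (rule sandwich_power[where M = UNIV, OF \<iota>_add _ _ _ _ _ _ _ P RN])
    fix z assume z: "z \<in> ?N"
    have "sandwich q b \<iota> x * z \<in> ?N"
      unfolding sandwich_def sum_distrib_right using left[OF z]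
      by (intro complex_space.span_sum) auto
    then show "P * z \<in> ?N"
      unfolding P distrib_right using Rz[OF z] by (rule complex_space.span_add)
  next
    fix u v i r s j assume le: "i \<le> q" "r \<le> q" "s \<le> q" "j \<le> q"
    \<comment> \<open>Merging two sandwiches costs exactly the word with this centred factor between \<open>\<iota> u\<close> and \<open>\<iota> v\<close>.\<close>
    define c where "c = b r * b s + (- (if r = s then 1 else 0)) *\<^sub>C 1"
    have "b r \<in> B" "b s \<in> B" using bB le by auto
    then have "c \<in> B"
      unfolding c_def using subB one unfolding star_subalgebra_def by blast
    moreover have "\<tau> c = 0"
    proof -
      have "\<tau> (u + v) = \<tau> u + \<tau> v" "\<tau> (t *\<^sub>C u) = t * \<tau> u" "\<tau> 1 = 1" for u v t
        using prob unfolding nc_probability_space_def tracial_weight_def linear_functional_on_def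
        by blast+
      moreover have "\<tau> (b r * b s) = (if r = s then 1 else 0)"
        using b_orthonormal le by simp
      ultimately have "\<tau> c = (if r = s then 1 else 0) + - (if r = s then 1 else 0) * 1"
        unfolding c_def by (simp only:)
      then show ?thesis by simp
    qed
    ultimately have core: "\<iota> u * c * \<iota> v \<in> ?N"
      using \<iota>A one by (intro cspan_centred_words_base)
    have "b i * (\<iota> u * c * \<iota> v) * b j \<in> ?N"
      by (rule absorb(2), use bB le in simp, rule absorb(1)) (use bB le core in simp_all)
    moreover have c_eq: "c = b r * b s - (if r = s then 1 else 0)"
      unfolding c_def by (auto simp: scaleC_one complex_space.scale_minus_left)
    have "b i * (\<iota> u * c * \<iota> v) * b j = (b i * \<iota> u * b r) * (b s * \<iota> v * b j)
      - (if r = s then b i * \<iota> (u * v) * b j else 0)"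
      unfolding c_eq
      by (simp add: \<iota>_mult left_diff_distrib right_diff_distrib mult.assoc)
    ultimately show "(b i * \<iota> u * b r) * (b s * \<iota> v * b j)
      - (if r = s then b i * \<iota> (u * v) * b j else 0) \<in> ?N" by simp
  qed (auto simp: complex_space.span_zero complex_space.span_add right[OF RN])
  moreover have "P ^ Suc m = ((*) P ^^ m) P"
    by (induction m) simp_all
  ultimately show ?thesis by simp
qed

theorem theorem3p4:
  fixes \<tau> :: "'c::star_algebra_1 \<Rightarrow> complex"
    and A B :: "'c set"
    and \<iota> :: "minf \<Rightarrow> 'c"
    and a :: "nat \<Rightarrow> minf" and b :: "nat \<Rightarrow> 'c"
    and p q k :: nat
    and lam :: "nat \<Rightarrow> nat \<Rightarrow> nat \<Rightarrow> complex"
    and P R :: 'c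
    and D Dt :: "'c set" and \<omega> \<omega>t :: "'c \<Rightarrow> complex"
  assumes prob: "nc_probability_space \<tau>"
    and subA: "star_subalgebra A" and subB: "star_subalgebra B" and one: "1 \<in> B"
    and iota: "star_hom \<iota>" "inj \<iota>" "range \<iota> = A"
    and a_sa: "\<And>j. j \<in> {1..p} \<Longrightarrow> star (a j) = a j"
    and b_sa: "\<And>i. i \<in> {0..q} \<Longrightarrow> b i \<in> B \<and> star (b i) = b i"
    and b0: "b 0 = 1"
    and b_centred: "\<And>i. i \<in> {1..q} \<Longrightarrow> \<tau> (b i) = 0"
    and b_orthonormal: "\<And>i j. i \<in> {0..q} \<Longrightarrow> j \<in> {0..q} \<Longrightarrow> \<tau> (b i * b j) = (if i = j then 1 else 0)"
    and R: "R \<in> cspan (alternating_monomials 2 p q (\<lambda>j. \<iota> (a j)) b)"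
    and P: "P = (\<Sum>i1\<in>{0..q}. \<Sum>i2\<in>{0..q}. \<Sum>j\<in>{1..p}.
                   lam i1 i2 j *\<^sub>C (b i1 * \<iota> (a j) * b i2)) + R"
    and k: "1 \<le> k"
  shows
    "(tracial_weight D \<omega> \<and> (\<forall>x. \<iota> x \<in> D \<and> \<omega> (\<iota> x) = Tr x) \<and> cyclically_monotone A B \<tau> D \<omega>
        \<longrightarrow> P ^ k \<in> D \<and>
            (\<exists>L. (\<forall>n. (\<forall>j\<in>{1..p}. a j \<in> M_corner n) \<longrightarrow>
                       (\<lambda>l. eta l (minf_power (P_tilde p q lam a n) k)) \<longlonglongrightarrow> L n)
                 \<and> L \<longlonglongrightarrow> \<omega> (P ^ k)))
     \<and>
     (linear_functional_on Dt \<omega>t \<and> (\<forall>x. \<iota> x \<in> Dt \<and> \<omega>t (\<iota> x) = Tr x) \<and> monotone_indep A B \<tau> Dt \<omega>t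
        \<longrightarrow> P ^ k \<in> Dt \<and>
            (\<exists>L. (\<forall>l. (\<lambda>n. eta l (minf_power (P_tilde p q lam a n) k)) \<longlonglongrightarrow> L l)
                 \<and> L \<longlonglongrightarrow> \<omega>t (P ^ k)))"
proof -
  define x where "x = (\<lambda>i j. \<Sum>s\<in>{1..p}. lam i j s *\<^sub>C a s)"
  obtain m where m: "k = Suc m" using k by (cases k) auto
  define X where "X = matrix_power_Suc q x m"
  let ?N = "cspan (centred_words \<tau> A B)"
  have \<iota>A: "\<iota> u \<in> A" for u using iota by auto
  have \<iota>_add: "\<iota> (u + v) = \<iota> u + \<iota> v" and \<iota>_scale: "\<iota> (r *\<^sub>C u) = r *\<^sub>C \<iota> u" for u v r
    using iota unfolding star_hom_def by auto
  have \<iota>0: "\<iota> 0 = 0" using \<iota>_add[of 0 0] by simp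
  have \<iota>_sum: "\<iota> (\<Sum>s\<in>{1..p}. g s) = (\<Sum>s\<in>{1..p}. \<iota> (g s))" for g
    using \<iota>_add \<iota>0 by (intro sum_comp_morphism[symmetric, unfolded o_def]) auto
  have Px: "P = sandwich q b \<iota> x + R"
    unfolding P sandwich_def x_def
    by (simp add: \<iota>_sum \<iota>_scale sum_distrib_left sum_distrib_right mult_scaleC_left mult_scaleC_right
        del: One_nat_def)
  have diff: "P ^ k - sandwich q b \<iota> X \<in> ?N"
    unfolding m X_def
    using power_mod_centred_words[OF prob subB one iota(1,3) _ b_centred b_orthonormal R Px] b_sa by blast
  \<comment> \<open>The two functionals enter this step only through linearity, their domain and vanishing on \<open>N\<close>.\<close>
  have moment: "P ^ k \<in> E \<and> \<theta> (P ^ k) = (\<Sum>i\<in>{0..q}. \<Sum>j\<in>{0..q}. \<theta> (b i * \<iota> (X i j) * b j))"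
    if lin: "linear_functional_on E \<theta>" and idl: "ideal_over B A \<subseteq> E"
      and van: "\<And>z. z \<in> ?N \<Longrightarrow> \<theta> z = 0" for E \<theta>
  proof -
    let ?z = "P ^ k - sandwich q b \<iota> X"
    have E: "b i * \<iota> (X i j) * b j \<in> E" if "i \<in> {0..q}" "j \<in> {0..q}" for i j
      using sandwich_in_ideal[OF \<iota>A] b_sa that idl by blast
    have S: "sandwich q b \<iota> X \<in> E \<and>
      \<theta> (sandwich q b \<iota> X) = (\<Sum>i\<in>{0..q}. \<Sum>j\<in>{0..q}. \<theta> (b i * \<iota> (X i j) * b j))"
    proof -
      have "(\<Sum>j\<in>{0..q}. b i * \<iota> (X i j) * b j) \<in> E \<and>
          \<theta> (\<Sum>j\<in>{0..q}. b i * \<iota> (X i j) * b j) = (\<Sum>j\<in>{0..q}. \<theta> (b i * \<iota> (X i j) * b j))"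
        if "i \<in> {0..q}" for i
        using E[OF that] by (rule linear_functional_on_sum[OF lin])
      then show ?thesis
        unfolding sandwich_def
        using linear_functional_on_sum[OF lin, of "{0..q}" "\<lambda>i. \<Sum>j\<in>{0..q}. b i * \<iota> (X i j) * b j"]
        by simp
    qed
    have z: "?z \<in> E" using diff centred_words_subset_ideal idl by blast
    have "?z + sandwich q b \<iota> X \<in> E \<and> \<theta> (?z + sandwich q b \<iota> X) = \<theta> ?z + \<theta> (sandwich q b \<iota> X)"
      using lin z S unfolding linear_functional_on_def star_subalgebra_def by blast
    then show ?thesis using S van[OF diff] by simp
  qed
  have model: "eta l (minf_power (P_tilde p q lam a n) k)
      = (\<Sum>i\<in>{0..q}. \<Sum>j\<in>{0..q}. eta l (b_tilde q n i * X i j * b_tilde q n j))"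
    and XM: "X i j \<in> M_corner n"
    if "\<forall>j\<in>{1..p}. a j \<in> M_corner n" for n l i j
    using P_tilde_power[of p a n, folded x_def] that
    by (simp_all add: m X_def sandwich_def eta_sum x_def)
  show ?thesis
  proof (intro conjI impI)
    assume H: "tracial_weight D \<omega> \<and> (\<forall>x. \<iota> x \<in> D \<and> \<omega> (\<iota> x) = Tr x) \<and> cyclically_monotone A B \<tau> D \<omega>"
    then have lin: "linear_functional_on D \<omega>" and cm: "cyclically_monotone A B \<tau> D \<omega>"
      and tr: "\<And>x. \<omega> (\<iota> x) = Tr x" and idl: "ideal_over B A \<subseteq> D"
      by (auto simp: tracial_weight_def cyclically_monotone_def)
    have v: "P ^ k \<in> D \<and>
        \<omega> (P ^ k) = (\<Sum>i\<in>{0..q}. \<Sum>j\<in>{0..q}. \<omega> (b i * \<iota> (X i j) * b j))"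
      by (rule moment[OF lin idl]) (rule cyclically_monotone_vanish[OF cm lin])
    then show "P ^ k \<in> D" by blast
    have "\<omega> (P ^ k) = (\<Sum>i\<in>{0..q}. \<Sum>j\<in>{0..q}. if i = j then Tr (X i j) else 0)"
      unfolding v[THEN conjunct2]
      using cyclically_monotone_sandwich[OF cm \<iota>A] b_sa
      by (intro sum.cong refl) (auto simp: b_orthonormal tr)
    then have "eta l (minf_power (P_tilde p q lam a n) k) = \<omega> (P ^ k)"
      if "\<forall>j\<in>{1..p}. a j \<in> M_corner n" "2 ^ q * n \<le> l" for n l
      using that by (simp add: model eta_sandwich_large XM)
    then have "\<forall>\<^sub>F l in sequentially. eta l (minf_power (P_tilde p q lam a n) k) = \<omega> (P ^ k)"
      if "\<forall>j\<in>{1..p}. a j \<in> M_corner n" for n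
      using that unfolding eventually_sequentially by blast
    then show "\<exists>L. (\<forall>n. (\<forall>j\<in>{1..p}. a j \<in> M_corner n) \<longrightarrow>
        (\<lambda>l. eta l (minf_power (P_tilde p q lam a n) k)) \<longlonglongrightarrow> L n) \<and> L \<longlonglongrightarrow> \<omega> (P ^ k)"
      by (intro exI[of _ "\<lambda>_. \<omega> (P ^ k)"]) (auto intro: tendsto_eventually)
  next
    assume H: "linear_functional_on Dt \<omega>t \<and> (\<forall>x. \<iota> x \<in> Dt \<and> \<omega>t (\<iota> x) = Tr x) \<and> monotone_indep A B \<tau> Dt \<omega>t"
    then have lin: "linear_functional_on Dt \<omega>t" and mi: "monotone_indep A B \<tau> Dt \<omega>t"
      and tr: "\<And>x. \<omega>t (\<iota> x) = Tr x" and idl: "ideal_over B A \<subseteq> Dt"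
      by (auto simp: monotone_indep_def)
    have v: "P ^ k \<in> Dt \<and>
        \<omega>t (P ^ k) = (\<Sum>i\<in>{0..q}. \<Sum>j\<in>{0..q}. \<omega>t (b i * \<iota> (X i j) * b j))"
      by (rule moment[OF lin idl]) (rule monotone_indep_vanish[OF mi lin])
    then show "P ^ k \<in> Dt" by blast
    have corner_sum: "(\<Sum>i\<in>{0..q}. \<Sum>j\<in>{0..q}. if i = 0 \<and> j = 0 then g i j else 0) = g 0 0"
      for g :: "nat \<Rightarrow> nat \<Rightarrow> complex"
    proof -
      have "(\<Sum>j\<in>{0..q}. if i = 0 \<and> j = 0 then g i j else 0) = (if i = 0 then g 0 0 else 0)" for i
        by (cases "i = 0") (simp_all add: sum.delta)
      then show ?thesis by (simp add: sum.delta)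
    qed
    have \<tau>b: "\<tau> (b i) = (if i = 0 then 1 else 0)" if "i \<in> {0..q}" for i
      using that b_centred b0 prob by (auto simp: nc_probability_space_def)
    have "\<omega>t (P ^ k) = (\<Sum>i\<in>{0..q}. \<Sum>j\<in>{0..q}. if i = 0 \<and> j = 0 then Tr (X i j) else 0)"
      unfolding v[THEN conjunct2]
      using monotone_indep_sandwich[OF mi \<iota>A] b_sa
      by (intro sum.cong refl) (auto simp: \<tau>b tr)
    then have \<omega>t: "\<omega>t (P ^ k) = Tr (X 0 0)" by (simp only: corner_sum)
    have "\<exists>n. a j \<in> M_corner n" for j using Union_M_corner by blast
    then obtain d where d: "\<And>j. a j \<in> M_corner (d j)" by metis
    define n0 where "n0 = Max (insert 0 (d ` {1..p}))"
    have n0: "\<forall>j\<in>{1..p}. a j \<in> M_corner n" if "n0 \<le> n" for n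
      using M_corner_mono[OF d] that by (auto simp: n0_def)
    have "\<forall>\<^sub>F n in sequentially. eta l (minf_power (P_tilde p q lam a n) k) = eta l (X 0 0)" for l
      using eventually_ge_at_top[of "max n0 l"]
    proof eventually_elim
      case (elim n)
      then have c: "\<forall>j\<in>{1..p}. a j \<in> M_corner n" and "l \<le> n" using n0 by auto
      then have "eta l (minf_power (P_tilde p q lam a n) k)
        = (\<Sum>i\<in>{0..q}. \<Sum>j\<in>{0..q}. if i = 0 \<and> j = 0 then eta l (X i j) else 0)"
        unfolding model[OF c] by (intro sum.cong refl) (simp add: eta_sandwich_small XM[OF c])
      then show ?case by (simp only: corner_sum)
    qed
    moreover have "\<forall>\<^sub>F l in sequentially. eta l (X 0 0) = \<omega>t (P ^ k)"
      using eventually_ge_at_top[of n0]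
      by eventually_elim (simp add: \<omega>t eta_eq_Tr XM n0)
    ultimately show "\<exists>L. (\<forall>l. (\<lambda>n. eta l (minf_power (P_tilde p q lam a n) k)) \<longlonglongrightarrow> L l)
        \<and> L \<longlonglongrightarrow> \<omega>t (P ^ k)"
      by (intro exI[of _ "\<lambda>l. eta l (X 0 0)"]) (auto intro: tendsto_eventually)
  qed
qed

end
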